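(* Let $G$ be a finite simple graph on $[n]$ with edge ideal $I(G)\subset S=K[x_1,\dots,x_n]$. For all integers $k\ge1$, $$\mathrm{HS}_1(I(G)^{k+1})=I(G)\cdot\mathrm{HS}_1(I(G)^k).$$ In particular, $\mathrm{HS}_1(\mathcal{R}(I(G)))=\bigoplus_{k\ge1}\mathrm{HS}_1(I(G)^k)$ is an $\mathcal{R}(I(G))$-module generated in degree one (that is, by its component $\mathrm{HS}_1(I(G))$ of degree $k=1$).
   Context: $K$ is a field and $S=K[x_1,\dots,x_n]$ is the standard graded polynomial ring. For a finite simple graph $G$ with vertex set $[n]=\{1,\dots,n\}$ and edge set $E(G)$, the edge ideal $I(G)\subset S$ is the ideal generated by the monomials $x_ix_j$ with $\{i,j\}\in E(G)$. For ${\bf a}=(a_1,\dots,a_n)\in\mathbb{Z}_{\ge0}^n$ put ${\bf x}^{\bf a}=x_1^{a_1}\cdots x_n^{a_n}$. The $i$th homological shift ideal of a monomial ideal $I\subset S$ is $\mathrm{HS}_i(I)=({\bf x}^{\bf a} : \mathrm{Tor}_i^S(K,I)_{\bf a}\ne0)$. $\mathcal{R}(I)=\bigoplus_{k\ge0}I^k$ (with $I^0=S$) is the Rees algebra of $I$. The $i$th homological shift algebra of $I$ is $\mathrm{HS}_i(\mathcal{R}(I))=\bigoplus_{k\ge1}\mathrm{HS}_i(I^k)$. It is an $\mathcal{R}(I)$-module, under the natural multiplication, precisely when $I\cdot\mathrm{HS}_i(I^k)\subseteq\mathrm{HS}_i(I^{k+1})$ for all $k\ge1$. *)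

theory Defs
  imports
    "HOL-Library.Poly_Mapping"
    "HOL-Computational_Algebra.Polynomial"
    "HOL-Algebra.Ideal_Product"
    "HOL-Algebra.Module"
    "Jordan_Normal_Form.Matrix_Kernel"
begin

text \<open>
  The polynomial ring \<open>S = K[x\<^sub>1, \<dots>, x\<^sub>n]\<close> is the monoid algebra over the exponent vectors:
  \<open>'n\<close> is a finite type with \<open>n\<close> elements that indexes the variables, and the whole type
  \<open>('n, 'k) mpoly\<close> is \<open>S\<close>.
\<close>

type_synonym ('n, 'k) mpoly = "('n \<Rightarrow>\<^sub>0 nat) \<Rightarrow>\<^sub>0 'k"

definition S_ring :: "('n, 'k::field) mpoly ring" where
  "S_ring = \<lparr>carrier = UNIV, mult = (*), one = 1, zero = 0, add = (+)\<rparr>"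

definition xpow :: "('n \<Rightarrow>\<^sub>0 nat) \<Rightarrow> ('n, 'k::field) mpoly" where
  "xpow a = Poly_Mapping.single a 1"

definition var :: "'n \<Rightarrow> ('n, 'k::field) mpoly" where
  "var i = xpow (Poly_Mapping.single i 1)"

abbreviation ideal_mult ::
    "('n, 'k::field) mpoly set \<Rightarrow> ('n, 'k) mpoly set \<Rightarrow> ('n, 'k) mpoly set"
    (infixl \<open>\<cdot>\<^sub>S\<close> 80) where
  "I \<cdot>\<^sub>S J \<equiv> ideal_prod S_ring I J"

text \<open>The power in the library's monoid of ideals, whose unit is the unit ideal; so \<open>I\<^sup>0 = S\<close>.\<close>

abbreviation ideal_power ::
    "('n, 'k::field) mpoly set \<Rightarrow> nat \<Rightarrow> ('n, 'k) mpoly set" (infixr \<open>^\<^sub>S\<close> 85) where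
  "I ^\<^sub>S k \<equiv> I [^]\<^bsub>ideals_set S_ring\<^esub> k"


section \<open>Edge ideals\<close>

definition simple_graph :: "'n::finite set set \<Rightarrow> bool" where
  "simple_graph E \<longleftrightarrow> (\<forall>e\<in>E. card e = 2)"

definition edge_ideal :: "'n::finite set set \<Rightarrow> ('n, 'k::field) mpoly set" where
  "edge_ideal E = Idl\<^bsub>S_ring\<^esub> {var i * var j | i j. {i, j} \<in> E}"


section \<open>Multigraded Tor\<close>

text \<open>
  A complex of multigraded free modules of finite rank
  \<open>\<dots> \<rightarrow> P\<^sub>2 \<rightarrow> P\<^sub>1 \<rightarrow> P\<^sub>0 \<rightarrow> K\<close>, where \<open>P\<^sub>i\<close> is the direct sum of the \<open>S(-shift i j)\<close> with
  \<open>j < rank i\<close>. The matrix \<open>diff i\<close> represents the map \<open>P\<^sub>i\<^sub>+\<^sub>1 \<rightarrow> P\<^sub>i\<close>, acting on column vectors,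
  and \<open>aug $ j\<close> is the image in \<open>K = S/(x\<^sub>1, \<dots>, x\<^sub>n)\<close> of the \<open>j\<close>-th basis element of \<open>P\<^sub>0\<close>.
\<close>

record (overloaded) ('n, 'k) free_complex =
  rank :: "nat \<Rightarrow> nat"
  shift :: "nat \<Rightarrow> nat \<Rightarrow> ('n \<Rightarrow>\<^sub>0 nat)"
  diff :: "nat \<Rightarrow> ('n, 'k) mpoly mat"
  aug :: "'k vec"

text \<open>
  The variables act as zero on \<open>K\<close>, hence a coefficient \<open>f\<close> acts on \<open>K\<close> through its constant term.
\<close>

definition augmentation :: "('n::finite, 'k::field) free_complex \<Rightarrow> ('n, 'k) mpoly vec \<Rightarrow> 'k" where
  "augmentation P v = aug P \<bullet> map_vec (\<lambda>f. Poly_Mapping.lookup f 0) v"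

text \<open>
  Exactness is required at every place, including surjectivity onto \<open>K\<close>. All maps are homogeneous
  of multidegree \<open>0\<close>; \<open>K\<close> lives in multidegree \<open>0\<close>.
\<close>

definition graded_free_resolution_of_K :: "('n::finite, 'k::field) free_complex \<Rightarrow> bool" where
  "graded_free_resolution_of_K P \<longleftrightarrow>
     aug P \<in> carrier_vec (rank P 0) \<and>
     (\<forall>j < rank P 0. aug P $ j \<noteq> 0 \<longrightarrow> shift P 0 j = 0) \<and>
     (\<forall>i. diff P i \<in> carrier_mat (rank P i) (rank P (Suc i))) \<and>
     (\<forall>i. \<forall>l < rank P i. \<forall>j < rank P (Suc i).
        \<forall>b \<in> Poly_Mapping.keys (diff P i $$ (l, j)). b + shift P i l = shift P (Suc i) j) \<and>
     augmentation P ` carrier_vec (rank P 0) = UNIV \<and>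
     {v \<in> carrier_vec (rank P 0). augmentation P v = 0}
       = (\<lambda>w. diff P 0 *\<^sub>v w) ` carrier_vec (rank P 1) \<and>
     (\<forall>i. mat_kernel (diff P i)
       = (\<lambda>w. diff P (Suc i) *\<^sub>v w) ` carrier_vec (rank P (Suc (Suc i))))"

text \<open>
  For an ideal \<open>I\<close> of \<open>S\<close>, the module \<open>P\<^sub>i \<otimes>\<^sub>S I\<close> is the direct sum of the \<open>I(-shift i j)\<close>: its
  elements are the vectors of length \<open>rank i\<close> with entries in \<open>I\<close>, and in multidegree \<open>a\<close> the
  \<open>j\<close>-th entry is homogeneous of multidegree \<open>a - shift i j\<close> (in particular \<open>0\<close> if
  \<open>shift i j\<close> is not below \<open>a\<close>). The differential is given by the same matrices.
\<close>

definition tensor_part ::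
    "('n::finite, 'k::field) free_complex \<Rightarrow> ('n, 'k) mpoly set \<Rightarrow> nat \<Rightarrow> ('n \<Rightarrow>\<^sub>0 nat)
      \<Rightarrow> ('n, 'k) mpoly vec set" where
  "tensor_part P I i a =
     {v \<in> carrier_vec (rank P i). \<forall>j < rank P i.
        v $ j \<in> I \<and> (\<forall>b \<in> Poly_Mapping.keys (v $ j). b + shift P i j = a)}"

definition tensor_cycles ::
    "('n::finite, 'k::field) free_complex \<Rightarrow> ('n, 'k) mpoly set \<Rightarrow> nat \<Rightarrow> ('n \<Rightarrow>\<^sub>0 nat)
      \<Rightarrow> ('n, 'k) mpoly vec set" where
  "tensor_cycles P I i a =
     (case i of 0 \<Rightarrow> tensor_part P I 0 a
      | Suc m \<Rightarrow> {v \<in> tensor_part P I (Suc m) a. diff P m *\<^sub>v v = 0\<^sub>v (rank P m)})"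

definition tensor_boundaries ::
    "('n::finite, 'k::field) free_complex \<Rightarrow> ('n, 'k) mpoly set \<Rightarrow> nat \<Rightarrow> ('n \<Rightarrow>\<^sub>0 nat)
      \<Rightarrow> ('n, 'k) mpoly vec set" where
  "tensor_boundaries P I i a = (\<lambda>w. diff P i *\<^sub>v w) ` tensor_part P I (Suc i) a"

text \<open>
  \<open>Tor\<^sub>i\<^sup>S(K, I)\<^sub>a \<noteq> 0\<close>, where \<open>Tor\<^sub>i\<^sup>S(K, I)\<close> is the homology of \<open>P \<otimes>\<^sub>S I\<close> for a multigraded free
  resolution \<open>P\<close> of \<open>K\<close>. Resolutions exist (for instance the Koszul complex on the variables) and
  the homology does not depend on the choice of \<open>P\<close>.
\<close>

definition Tor_nonzero ::
    "nat \<Rightarrow> ('n::finite, 'k::field) mpoly set \<Rightarrow> ('n \<Rightarrow>\<^sub>0 nat) \<Rightarrow> bool" where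
  "Tor_nonzero i I a \<longleftrightarrow>
     (\<exists>P. graded_free_resolution_of_K P \<and> tensor_cycles P I i a \<noteq> tensor_boundaries P I i a)"


section \<open>Homological shift ideals and algebras\<close>

definition HS :: "nat \<Rightarrow> ('n::finite, 'k::field) mpoly set \<Rightarrow> ('n, 'k) mpoly set" where
  "HS i I = Idl\<^bsub>S_ring\<^esub> {xpow a | a. Tor_nonzero i I a}"

text \<open>
  Both \<open>\<Oplus>\<^sub>k\<^sub>\<ge>\<^sub>0 I\<^sup>k\<close> and \<open>\<Oplus>\<^sub>k\<^sub>\<ge>\<^sub>1 HS\<^sub>i(I\<^sup>k)\<close> are realised inside the univariate polynomial ring \<open>S[t]\<close>,
  the component of degree \<open>k\<close> being placed at \<open>t\<^sup>k\<close>. Ring multiplication and scalar multiplication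
  are those of \<open>S[t]\<close>.
\<close>

definition rees :: "('n, 'k::field) mpoly set \<Rightarrow> ('n, 'k) mpoly poly ring" where
  "rees I = \<lparr>carrier = {p. \<forall>k. coeff p k \<in> I ^\<^sub>S k},
             mult = (*), one = 1, zero = 0, add = (+)\<rparr>"

text \<open>
  The fields \<open>mult\<close> and \<open>one\<close> of a module record play no role in \<^locale>\<open>Module.module\<close>.
\<close>

definition HS_algebra ::
    "nat \<Rightarrow> ('n::finite, 'k::field) mpoly set \<Rightarrow> (('n, 'k) mpoly poly, ('n, 'k) mpoly poly) module" where
  "HS_algebra i I =
     \<lparr>carrier = {p. coeff p 0 = 0 \<and> (\<forall>k\<ge>1. coeff p k \<in> HS i (I ^\<^sub>S k))},
      mult = (*), one = 1, zero = 0, add = (+), smult = (*)\<rparr>"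

definition graded_component :: "nat \<Rightarrow> ('r, 's::zero poly) module \<Rightarrow> 's poly set" where
  "graded_component k M = {m \<in> carrier M. \<exists>f. m = monom f k}"

definition generated_in_degree ::
    "nat \<Rightarrow> 'r ring \<Rightarrow> ('r, 's::zero poly) module \<Rightarrow> bool" where
  "generated_in_degree k R M \<longleftrightarrow>
     \<Inter>{N. Module.submodule N R M \<and> graded_component k M \<subseteq> N} = carrier M"

end

theory Submission
  imports Defs
begin

text \<open>
  The key is a description of \<open>HS\<^sub>1\<close> of a monomial ideal \<open>J\<close> with minimal generators \<open>G\<close>: it is
  generated by the monomials that are divisible by two distinct elements of \<open>G\<close>
  (\<open>HS_1_monomial_ideal\<close>). This has two halves.
  
  If at most one generator \<open>x\<^sup>g\<close> divides \<open>x\<^sup>a\<close>, then \<open>J\<close> agrees below the multidegree \<open>a\<close> with the free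
  module \<open>x\<^sup>g S\<close> or with \<open>0\<close>, so the higher Tor of \<open>J\<close> vanishes in multidegree \<open>a\<close>, whatever the
  resolution of \<open>K\<close> (\<open>Tor_nonzero_imp_two_generators\<close>).
  
  If \<open>x\<^sup>b\<close> is minimal among the monomials divisible by two distinct generators, consider the variables
  \<open>x\<^sub>p\<close> with \<open>x\<^sup>b / x\<^sub>p \<in> J\<close>. Each of them belongs to exactly one generator, and variables belonging to
  different generators are not linked by a boundary, so the difference of two such variables is a
  nonzero homology class (\<open>Tor_1_nonzero_minimal_common_multiple\<close>). This half needs one resolution of
  \<open>K\<close>, and the ordered chain complexes of the simplices on the variables dividing a given monomial
  provide one (\<open>resolution_simplex\<close>).
  
  For the edge ideal \<open>I\<close>, the minimal generators of \<open>I\<^sup>k\<close> are the products of \<open>k\<close> edges, because these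
  all have degree \<open>2k\<close>. Multiplying two distinct products of \<open>k\<close> edges by an edge keeps them distinct,
  which gives \<open>I \<cdot> HS\<^sub>1(I\<^sup>k) \<subseteq> HS\<^sub>1(I\<^sup>k\<^sup>+\<^sup>1)\<close>. The reverse inclusion says that two distinct products of
  \<open>k + 1 \<ge> 2\<close> edges dividing \<open>x\<^sup>a\<close> can be replaced by two distinct ones that share an edge
  (\<open>edge_exchange\<close>). The assertions on the module over the Rees algebra follow formally.
\<close>

abbreviation (input) lookup where "lookup \<equiv> Poly_Mapping.lookup"
abbreviation (input) keys where "keys \<equiv> Poly_Mapping.keys"
abbreviation (input) single where "single \<equiv> Poly_Mapping.single"

section \<open>Monomial ideals\<close>

definition exp_le :: "('n \<Rightarrow>\<^sub>0 nat) \<Rightarrow> ('n \<Rightarrow>\<^sub>0 nat) \<Rightarrow> bool" (infix \<open>\<preceq>\<close> 50) where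
  "u \<preceq> a \<longleftrightarrow> (\<forall>i. lookup u i \<le> lookup a i)"

lemma exp_leI: "(\<And>i. lookup u i \<le> lookup a i) \<Longrightarrow> u \<preceq> a"
  by (simp add: exp_le_def)

lemma exp_leD: "u \<preceq> a \<Longrightarrow> lookup u i \<le> lookup a i"
  by (simp add: exp_le_def)

lemma exp_le_refl [simp]: "u \<preceq> u"
  by (simp add: exp_le_def)

lemma exp_le_trans: "u \<preceq> v \<Longrightarrow> v \<preceq> w \<Longrightarrow> u \<preceq> w"
  unfolding exp_le_def using le_trans by blast

lemma exp_le_add_right [simp]: "u \<preceq> u + c"
  by (simp add: exp_le_def lookup_add)

lemma exp_le_add_left [simp]: "u \<preceq> c + u"
  by (simp add: exp_le_def lookup_add)

lemma zero_exp_le [simp]: "0 \<preceq> a"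
  by (simp add: exp_le_def)

lemma exp_le_add_mono: "u \<preceq> a \<Longrightarrow> v \<preceq> b \<Longrightarrow> u + v \<preceq> a + b"
  by (simp add: exp_le_def lookup_add add_mono)

lemma exp_le_diff_add: "u \<preceq> a \<Longrightarrow> a - u + u = a"
  by (intro poly_mapping_eqI) (simp add: exp_le_def lookup_add lookup_minus)

lemma exp_le_iff_add: "u \<preceq> a \<longleftrightarrow> (\<exists>c. a = u + c)"
  by (metis exp_le_diff_add exp_le_add_right add.commute)

lemma keys_xpow [simp]: "keys (xpow a :: ('n, 'k::field) mpoly) = {a}"
  by (simp add: xpow_def)

lemma xpow_add: "xpow (a + b) = (xpow a * xpow b :: ('n, 'k::field) mpoly)"
  by (simp add: xpow_def mult_single)

text \<open>
  Multigraded pieces of free modules are handled through coefficients, and all the matrices that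
  occur have monomial entries; this is the one multiplication rule that those computations need.
\<close>

lemma lookup_single_times:
  fixes f :: "('n, 'k::field) mpoly"
  shows "lookup (single m c * f) b = (if m \<preceq> b then c * lookup f (b - m) else 0)"
proof -
  have "lookup (single m c * f) b = c * (\<Sum>q. lookup f q when b = m + q)"
    by (simp add: lookup_mult lookup_single when_mult)
  also have "\<dots> = (if m \<preceq> b then c * lookup f (b - m) else 0)"
  proof (cases "m \<preceq> b")
    case True
    then have "(b = m + q) = (q = b - m)" for q
      by (metis add_diff_cancel_left' exp_le_diff_add add.commute)
    with True show ?thesis by simp
  next
    case False
    then have "(b = m + q) = False" for q by auto
    with False show ?thesis by simp
  qed
  finally show ?thesis .
qed

lemma cring_S_ring: "cring (S_ring :: ('n, 'k::field) mpoly ring)"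
proof (rule cringI)
  show "abelian_group (S_ring :: ('n, 'k) mpoly ring)"
  proof (rule abelian_groupI)
    fix x :: "('n, 'k) mpoly"
    show "\<exists>y\<in>carrier S_ring. y \<oplus>\<^bsub>S_ring\<^esub> x = \<zero>\<^bsub>S_ring\<^esub>"
      by (rule bexI[of _ "- x"]) (simp_all add: S_ring_def)
  qed (simp_all add: S_ring_def algebra_simps)
  show "comm_monoid (S_ring :: ('n, 'k) mpoly ring)"
    by (rule comm_monoidI) (simp_all add: S_ring_def algebra_simps)
qed (simp add: S_ring_def algebra_simps)

lemma ring_S_ring: "ring (S_ring :: ('n, 'k::field) mpoly ring)"
  using cring_S_ring cring.axioms(1) by blast

lemma S_ring_simps [simp]:
  "carrier S_ring = UNIV" "mult S_ring = (*)" "one S_ring = 1" "zero S_ring = 0" "add S_ring = (+)"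
  by (simp_all add: S_ring_def)

lemma a_inv_S_ring [simp]: "a_inv S_ring f = - (f :: ('n, 'k::field) mpoly)"
proof -
  interpret cring "S_ring :: ('n, 'k) mpoly ring" by (rule cring_S_ring)
  show ?thesis using minus_equality[of "-f" f] by simp
qed

lemma ideal_S_ringI:
  fixes J :: "('n, 'k::field) mpoly set"
  assumes "0 \<in> J" "\<And>f g. f \<in> J \<Longrightarrow> g \<in> J \<Longrightarrow> f + g \<in> J" "\<And>f g. f \<in> J \<Longrightarrow> g * f \<in> J"
  shows "ideal J S_ring"
proof (rule idealI[OF ring_S_ring])
  interpret cring "S_ring :: ('n, 'k) mpoly ring" by (rule cring_S_ring)
  have "- f \<in> J" if "f \<in> J" for f
    using assms(3)[OF that, of "- 1"] by simp
  then show "subgroup J (add_monoid S_ring)"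
    using assms by (intro add.subgroupI) (auto simp flip: a_inv_def)
qed (use assms in \<open>auto simp: mult.commute\<close>)

context
  fixes J :: "('n, 'k::field) mpoly set"
  assumes J: "ideal J S_ring"
begin

lemma ideal_zero_mem: "0 \<in> J"
  using additive_subgroup.zero_closed[OF ideal.axioms(1)[OF J]] by simp

lemma ideal_add_mem: "f \<in> J \<Longrightarrow> g \<in> J \<Longrightarrow> f + g \<in> J"
  using additive_subgroup.a_closed[OF ideal.axioms(1)[OF J]] by simp

lemma ideal_mult_mem: "f \<in> J \<Longrightarrow> g * f \<in> J"
  using ideal.I_l_closed[OF J] by simp

lemma ideal_uminus_mem: "f \<in> J \<Longrightarrow> - f \<in> J"
  using ideal_mult_mem[of f "- 1"] by simp

lemma ideal_sum_mem: "(\<And>x. x \<in> A \<Longrightarrow> f x \<in> J) \<Longrightarrow> sum f A \<in> J"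
  by (induction A rule: infinite_finite_induct) (auto intro: ideal_zero_mem ideal_add_mem)

end

text \<open>
  The ideal generated by the monomials with exponents in \<open>G\<close>, described by its elements: a polynomial
  lies in a monomial ideal if and only if all its monomials do. The description makes membership
  computable without generators; the lemma \<open>genideal_xpow\<close> identifies it with the generated ideal.
\<close>

definition monomial_ideal :: "('n \<Rightarrow>\<^sub>0 nat) set \<Rightarrow> ('n, 'k::field) mpoly set" where
  "monomial_ideal G = {f. \<forall>b \<in> keys f. \<exists>g \<in> G. g \<preceq> b}"

lemma xpow_in_monomial_ideal_iff:
  "xpow a \<in> (monomial_ideal G :: ('n, 'k::field) mpoly set) \<longleftrightarrow> (\<exists>g\<in>G. g \<preceq> a)"
  by (simp add: monomial_ideal_def)

lemma xpow_in_monomial_ideal: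
  "a \<in> G \<Longrightarrow> xpow a \<in> (monomial_ideal G :: ('n, 'k::field) mpoly set)"
  unfolding xpow_in_monomial_ideal_iff using exp_le_refl by blast

lemma ideal_monomial_ideal: "ideal (monomial_ideal G :: ('n, 'k::field) mpoly set) S_ring"
proof (rule ideal_S_ringI)
  fix f g :: "('n, 'k) mpoly"
  assume f: "f \<in> monomial_ideal G"
  show "g * f \<in> monomial_ideal G"
    using f keys_mult[of g f] exp_le_trans[OF _ exp_le_add_left]
    unfolding monomial_ideal_def by blast
  assume "g \<in> monomial_ideal G"
  with f show "f + g \<in> monomial_ideal G"
    using keys_add[of f g] unfolding monomial_ideal_def by blast
qed (simp add: monomial_ideal_def)

lemma mpoly_sum_single:
  fixes f :: "('n, 'k::field) mpoly"
  shows "f = (\<Sum>b\<in>keys f. single b (lookup f b))"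
proof (rule poly_mapping_eqI)
  fix k
  have "lookup (\<Sum>b\<in>keys f. single b (lookup f b)) k = (\<Sum>b\<in>keys f. if b = k then lookup f b else 0)"
    unfolding lookup_sum by (rule sum.cong) (auto simp: lookup_single when_def)
  also have "\<dots> = lookup f k"
    by (simp add: sum.delta in_keys_iff)
  finally show "lookup f k = lookup (\<Sum>b\<in>keys f. single b (lookup f b)) k" ..
qed

lemma monomial_ideal_subset_ideal:
  fixes J :: "('n, 'k::field) mpoly set"
  assumes J: "ideal J S_ring" and G: "\<And>g. g \<in> G \<Longrightarrow> xpow g \<in> J"
  shows "monomial_ideal G \<subseteq> J"
proof
  fix f :: "('n, 'k) mpoly"
  assume f: "f \<in> monomial_ideal G"
  have "single b (lookup f b) \<in> J" if b: "b \<in> keys f" for b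
  proof -
    obtain g where g: "g \<in> G" "g \<preceq> b"
      using f b by (auto simp: monomial_ideal_def)
    have "single (b - g) (lookup f b) * xpow g = single b (lookup f b)"
      by (simp add: xpow_def mult_single exp_le_diff_add[OF g(2)])
    then show ?thesis
      using ideal_mult_mem[OF J G[OF g(1)]] by metis
  qed
  then show "f \<in> J"
    using mpoly_sum_single[of f] ideal_sum_mem[OF J] by metis
qed

lemma genideal_xpow:
  "Idl\<^bsub>S_ring\<^esub> {xpow a | a. a \<in> G} = (monomial_ideal G :: ('n, 'k::field) mpoly set)"
proof
  interpret cring "S_ring :: ('n, 'k) mpoly ring" by (rule cring_S_ring)
  show "Idl\<^bsub>S_ring\<^esub> {xpow a | a. a \<in> G} \<subseteq> (monomial_ideal G :: ('n, 'k) mpoly set)"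
    by (rule genideal_minimal[OF ideal_monomial_ideal])
       (auto intro: xpow_in_monomial_ideal)
  show "(monomial_ideal G :: ('n, 'k) mpoly set) \<subseteq> Idl\<^bsub>S_ring\<^esub> {xpow a | a. a \<in> G}"
  proof (rule monomial_ideal_subset_ideal)
    show "ideal (Idl\<^bsub>S_ring\<^esub> {xpow a | a. a \<in> G}) (S_ring :: ('n, 'k) mpoly ring)"
      by (rule genideal_ideal) simp
    show "(xpow g :: ('n, 'k) mpoly) \<in> Idl\<^bsub>S_ring\<^esub> {xpow a | a. a \<in> G}" if "g \<in> G" for g
      using genideal_self[of "{xpow a | a. a \<in> G}"] that by auto
  qed
qed

lemma monomial_ideal_mult:
  "monomial_ideal G \<cdot>\<^sub>S monomial_ideal H
     = (monomial_ideal {g + h | g h. g \<in> G \<and> h \<in> H} :: ('n, 'k::field) mpoly set)"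
    (is "?L = ?R")
proof
  interpret cring "S_ring :: ('n, 'k) mpoly ring" by (rule cring_S_ring)
  have prod: "f * f' \<in> ?R"
    if f: "f \<in> monomial_ideal G" "f' \<in> monomial_ideal H" for f f' :: "('n, 'k) mpoly"
    unfolding monomial_ideal_def
  proof (rule CollectI, rule ballI)
    fix b
    assume "b \<in> keys (f * f')"
    then obtain c d where "b = c + d" "c \<in> keys f" "d \<in> keys f'"
      using keys_mult[of f f'] by blast
    moreover obtain g h where "g \<in> G" "g \<preceq> c" "h \<in> H" "h \<preceq> d"
      using f calculation unfolding monomial_ideal_def by blast
    ultimately show "\<exists>x\<in>{g + h | g h. g \<in> G \<and> h \<in> H}. x \<preceq> b"
      using exp_le_add_mono by blast
  qed
  have "x \<in> ?R" if "x \<in> ?L" for x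
    using that by induction (simp_all add: prod ideal_add_mem[OF ideal_monomial_ideal])
  then show "?L \<subseteq> ?R" by blast
  have "xpow (g + h) \<in> ?L" if "g \<in> G" "h \<in> H" for g h
  proof -
    have "xpow g \<in> (monomial_ideal G :: ('n, 'k) mpoly set)"
      "xpow h \<in> (monomial_ideal H :: ('n, 'k) mpoly set)"
      using that by (simp_all add: xpow_in_monomial_ideal)
    from ideal_prod.prod[OF this, of S_ring] show ?thesis
      by (simp add: xpow_add)
  qed
  then show "?R \<subseteq> ?L"
    by (intro monomial_ideal_subset_ideal ideal_prod_is_ideal ideal_monomial_ideal) auto
qed

text \<open>
  Exponents of the products of \<open>k\<close> generators, hence generators of the \<open>k\<close>-th power of the ideal.
\<close>

fun sumset :: "nat \<Rightarrow> ('n \<Rightarrow>\<^sub>0 nat) set \<Rightarrow> ('n \<Rightarrow>\<^sub>0 nat) set" where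
  "sumset 0 G = {0}"
| "sumset (Suc k) G = {u + g | u g. u \<in> sumset k G \<and> g \<in> G}"

lemma ideal_power_0: "I ^\<^sub>S 0 = UNIV"
  by (simp add: ideals_set_def nat_pow_def)

lemma ideal_power_Suc: "I ^\<^sub>S Suc k = I ^\<^sub>S k \<cdot>\<^sub>S I"
  by (simp add: ideals_set_def nat_pow_def)

lemma monomial_ideal_power:
  "(monomial_ideal G) ^\<^sub>S k = (monomial_ideal (sumset k G) :: ('n, 'k::field) mpoly set)"
proof (induction k)
  case 0
  show ?case unfolding ideal_power_0 by (auto simp: monomial_ideal_def)
next
  case (Suc k)
  then show ?case by (simp only: ideal_power_Suc monomial_ideal_mult sumset.simps)
qed

section \<open>Vanishing of Tor below a unique generator\<close>

text \<open>
  The part of \<open>f\<close> that is homogeneous of multidegree \<open>a\<close> when \<open>f\<close> is regarded as an element of the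
  twisted module \<open>S(-s)\<close>, in which the generator \<open>1\<close> has multidegree \<open>s\<close>.
\<close>

definition component ::
    "('n \<Rightarrow>\<^sub>0 nat) \<Rightarrow> ('n \<Rightarrow>\<^sub>0 nat) \<Rightarrow> ('n, 'k::field) mpoly \<Rightarrow> ('n, 'k) mpoly" where
  "component a s f = Poly_Mapping.mapp (\<lambda>b c. if b + s = a then c else 0) f"

lemma lookup_component: "lookup (component a s f) b = (if b + s = a then lookup f b else 0)"
  by (auto simp: component_def lookup_mapp when_def in_keys_iff)

lemma keys_component: "b \<in> keys (component a s f) \<Longrightarrow> b + s = a"
  by (auto simp: in_keys_iff lookup_component split: if_splits)

lemma component_homogeneous: "(\<And>b. b \<in> keys f \<Longrightarrow> b + s = a) \<Longrightarrow> component a s f = f"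
  by (rule poly_mapping_eqI) (auto simp: lookup_component in_keys_iff)

lemma component_sum: "component a s (sum f A) = (\<Sum>x\<in>A. component a s (f x))"
  by (rule poly_mapping_eqI) (simp add: lookup_component lookup_sum)

text \<open>
  Maps of multidegree \<open>0\<close> between twisted modules commute with taking homogeneous parts. The
  hypothesis says that multiplication by \<open>M\<close> is such a map \<open>S(-t) \<rightarrow> S(-s)\<close>; by cancellation it forces
  \<open>M\<close> to be a single term.
\<close>

lemma component_times:
  assumes M: "\<And>b. b \<in> keys M \<Longrightarrow> b + s = t"
  shows "component a s (M * f) = M * component a t f"
proof (cases "M = 0")
  case True
  then show ?thesis by (simp add: poly_mapping_eqI lookup_component)
next
  case False
  then obtain m where m: "m \<in> keys M" by (metis in_keys_iff lookup_zero poly_mapping_eqI)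
  have "keys M = {m}"
    using m M by (auto, metis add_right_cancel)
  then have M_eq: "M = single m (lookup M m)"
    using mpoly_sum_single[of M] by simp
  have st: "m + s = t" using M[OF m] .
  have "lookup (component a s (single m (lookup M m) * f)) b
      = lookup (single m (lookup M m) * component a t f) b" for b
  proof (cases "m \<preceq> b")
    case True
    then obtain c where b: "b = m + c" by (auto simp: exp_le_iff_add)
    have "(m + c + s = a) = (c + t = a)"
      unfolding st[symmetric] by (simp add: ac_simps)
    then show ?thesis
      by (simp add: lookup_component lookup_single_times b)
  qed (simp add: lookup_component lookup_single_times)
  then show ?thesis
    using M_eq poly_mapping_eqI by metis
qed

lemma mult_mat_vec_nth:
  assumes "A \<in> carrier_mat m n" "v \<in> carrier_vec n" "l < m"
  shows "(A *\<^sub>v v) $ l = (\<Sum>j<n. A $$ (l, j) * v $ j)"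
  using assms by (auto simp: scalar_prod_def atLeast0LessThan intro!: sum.cong)

lemma tensor_partI:
  assumes "v \<in> carrier_vec (rank P i)"
    and "\<And>j. j < rank P i \<Longrightarrow> v $ j \<in> J"
    and "\<And>j b. j < rank P i \<Longrightarrow> b \<in> keys (v $ j) \<Longrightarrow> b + shift P i j = a"
  shows "v \<in> tensor_part P J i a"
  using assms by (auto simp: tensor_part_def)

lemma tensor_partD:
  assumes "v \<in> tensor_part P J i a"
  shows "v \<in> carrier_vec (rank P i)"
    and "j < rank P i \<Longrightarrow> v $ j \<in> J"
    and "j < rank P i \<Longrightarrow> b \<in> keys (v $ j) \<Longrightarrow> b + shift P i j = a"
  using assms by (auto simp: tensor_part_def)

context
  fixes P :: "('n::finite, 'k::field) free_complex"
  assumes P: "graded_free_resolution_of_K P"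
begin

lemma diff_carrier: "diff P i \<in> carrier_mat (rank P i) (rank P (Suc i))"
  using P by (simp add: graded_free_resolution_of_K_def)

lemma diff_homogeneous:
  "l < rank P i \<Longrightarrow> j < rank P (Suc i) \<Longrightarrow> b \<in> keys (diff P i $$ (l, j))
    \<Longrightarrow> b + shift P i l = shift P (Suc i) j"
  using P by (simp add: graded_free_resolution_of_K_def)

lemma diff_exact:
  "mat_kernel (diff P i) = (\<lambda>w. diff P (Suc i) *\<^sub>v w) ` carrier_vec (rank P (Suc (Suc i)))"
  using P by (simp add: graded_free_resolution_of_K_def)

lemma boundaries_subset_cycles:
  assumes J: "ideal J S_ring"
  shows "tensor_boundaries P J (Suc m) a \<subseteq> tensor_cycles P J (Suc m) a"
proof
  fix v
  assume "v \<in> tensor_boundaries P J (Suc m) a"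
  then obtain w where v: "v = diff P (Suc m) *\<^sub>v w"
    and w: "w \<in> tensor_part P J (Suc (Suc m)) a"
    by (auto simp: tensor_boundaries_def)
  note w_carrier = tensor_partD(1)[OF w]
  have v_nth: "v $ l = (\<Sum>j<rank P (Suc (Suc m)). diff P (Suc m) $$ (l, j) * w $ j)"
    if "l < rank P (Suc m)" for l
    unfolding v using mult_mat_vec_nth[OF diff_carrier w_carrier that] .
  have "v \<in> mat_kernel (diff P m)"
    unfolding diff_exact v using w_carrier by blast
  then have "v \<in> carrier_vec (rank P (Suc m))" "diff P m *\<^sub>v v = 0\<^sub>v (rank P m)"
    using mat_kernelD[OF diff_carrier] by blast+
  moreover have "v \<in> tensor_part P J (Suc m) a"
  proof (rule tensor_partI)
    fix l assume l: "l < rank P (Suc m)"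
    show "v $ l \<in> J"
      unfolding v_nth[OF l]
      by (intro ideal_sum_mem[OF J] ideal_mult_mem[OF J] tensor_partD(2)[OF w]) simp
    have "component a (shift P (Suc m) l) (diff P (Suc m) $$ (l, j) * w $ j)
        = diff P (Suc m) $$ (l, j) * w $ j" if j: "j < rank P (Suc (Suc m))" for j
      by (subst component_times[OF diff_homogeneous[OF l j]])
         (auto simp: component_homogeneous tensor_partD(3)[OF w j])
    then have "component a (shift P (Suc m) l) (v $ l) = v $ l"
      unfolding v_nth[OF l] component_sum by simp
    then show "b + shift P (Suc m) l = a" if "b \<in> keys (v $ l)" for b
      using that keys_component by metis
  qed fact
  ultimately show "v \<in> tensor_cycles P J (Suc m) a"
    by (simp add: tensor_cycles_def)
qed

text \<open>
  In multidegrees below \<open>a\<close> the ideal coincides with the principal ideal \<open>x\<^sup>g S\<close> of its only generator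
  that divides \<open>x\<^sup>a\<close> (or with \<open>0\<close> if there is none). Division by \<open>x\<^sup>g\<close> therefore turns a cycle of
  \<open>P \<otimes> I\<close> of multidegree \<open>a\<close> into a cycle of \<open>P\<close> of multidegree \<open>a - g\<close>, which bounds because \<open>P\<close> is
  exact. As this works for every resolution, no comparison of resolutions is required.
\<close>

lemma cycles_subset_boundaries_if_unique_generator:
  assumes unique: "\<And>u v. u \<in> G \<Longrightarrow> v \<in> G \<Longrightarrow> u \<preceq> a \<Longrightarrow> v \<preceq> a \<Longrightarrow> u = v"
  shows "tensor_cycles P (monomial_ideal G) (Suc m) a
    \<subseteq> tensor_boundaries P (monomial_ideal G) (Suc m) a"
proof
  fix z
  assume z: "z \<in> tensor_cycles P (monomial_ideal G) (Suc m) a"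
  then have z_part: "z \<in> tensor_part P (monomial_ideal G) (Suc m) a"
    and dz: "diff P m *\<^sub>v z = 0\<^sub>v (rank P m)"
    by (auto simp: tensor_cycles_def)
  have z_keys: "\<exists>g\<in>G. g \<preceq> b \<and> g \<preceq> a" if "l < rank P (Suc m)" "b \<in> keys (z $ l)" for l b
  proof -
    have "b \<preceq> a" using tensor_partD(3)[OF z_part that] exp_le_add_right by metis
    moreover have "\<exists>g\<in>G. g \<preceq> b"
      using tensor_partD(2)[OF z_part that(1)] that(2) unfolding monomial_ideal_def by blast
    ultimately show ?thesis using exp_le_trans by blast
  qed
  show "z \<in> tensor_boundaries P (monomial_ideal G) (Suc m) a"
  proof (cases "\<exists>g\<in>G. g \<preceq> a")
    case False
    have "z = 0\<^sub>v (rank P (Suc m))"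
    proof (rule eq_vecI)
      fix l assume "l < dim_vec (0\<^sub>v (rank P (Suc m)) :: ('n, 'k) mpoly vec)"
      then have l: "l < rank P (Suc m)" by simp
      then have "keys (z $ l) = {}" using z_keys False by blast
      then show "z $ l = 0\<^sub>v (rank P (Suc m)) $ l" using l by simp
    qed (use tensor_partD(1)[OF z_part] in auto)
    also have "\<dots> = diff P (Suc m) *\<^sub>v 0\<^sub>v (rank P (Suc (Suc m)))"
      using diff_carrier[of "Suc m"] by auto
    finally show ?thesis
      unfolding tensor_boundaries_def
      by (intro image_eqI[of _ _ "0\<^sub>v (rank P (Suc (Suc m)))"] tensor_partI)
         (auto simp: ideal_zero_mem[OF ideal_monomial_ideal])
  next
    case True
    then obtain g where g: "g \<in> G" "g \<preceq> a" by blast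
    have z_above: "g \<preceq> b" if "l < rank P (Suc m)" "b \<in> keys (z $ l)" for l b
      using z_keys[OF that] unique g by blast
    \<comment> \<open>The cycle divided by the monomial with exponent g.\<close>
    define w where "w = vec (rank P (Suc m)) (\<lambda>l. Poly_Mapping.map_key ((+) g) (z $ l))"
    have w_carrier: "w \<in> carrier_vec (rank P (Suc m))" by (simp add: w_def)
    have lookup_w: "lookup (w $ l) b = lookup (z $ l) (g + b)" if "l < rank P (Suc m)" for l b
      using that by (simp add: w_def map_key.rep_eq)
    have z_eq: "z $ l = xpow g * w $ l" if l: "l < rank P (Suc m)" for l
    proof (rule poly_mapping_eqI)
      fix b
      show "lookup (z $ l) b = lookup (xpow g * w $ l) b"
        using z_above[OF l, of b] exp_le_diff_add[of g b]
        by (auto simp: xpow_def lookup_single_times lookup_w[OF l] add.commute in_keys_iff)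
    qed
    have "diff P m *\<^sub>v w = 0\<^sub>v (rank P m)"
    proof (rule eq_vecI)
      fix l assume "l < dim_vec (0\<^sub>v (rank P m) :: ('n, 'k) mpoly vec)"
      then have l: "l < rank P m" by simp
      have "xpow g * (diff P m *\<^sub>v w) $ l = (diff P m *\<^sub>v z) $ l"
        unfolding mult_mat_vec_nth[OF diff_carrier w_carrier l]
          mult_mat_vec_nth[OF diff_carrier tensor_partD(1)[OF z_part] l] sum_distrib_left
        by (rule sum.cong) (auto simp: z_eq ac_simps)
      then have "xpow g * (diff P m *\<^sub>v w) $ l = 0" using dz l by simp
      then have "lookup (xpow g * (diff P m *\<^sub>v w) $ l) (g + b) = 0" for b by simp
      then have "lookup ((diff P m *\<^sub>v w) $ l) b = 0" for b
        by (simp add: xpow_def lookup_single_times)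
      then show "(diff P m *\<^sub>v w) $ l = 0\<^sub>v (rank P m) $ l"
        using l by (simp add: poly_mapping_eqI)
    qed (use diff_carrier[of m] in simp)
    then have "w \<in> mat_kernel (diff P m)"
      using mat_kernelI[OF diff_carrier w_carrier] by blast
    then obtain y where y: "y \<in> carrier_vec (rank P (Suc (Suc m)))" "w = diff P (Suc m) *\<^sub>v y"
      unfolding diff_exact by blast
    \<comment> \<open>The preimage y need not be homogeneous; only its part of multidegree a - g is kept.\<close>
    define z' where "z' = vec (rank P (Suc (Suc m)))
      (\<lambda>j. xpow g * component (a - g) (shift P (Suc (Suc m)) j) (y $ j))"
    have z'_carrier: "z' \<in> carrier_vec (rank P (Suc (Suc m)))" by (simp add: z'_def)
    have "z' \<in> tensor_part P (monomial_ideal G) (Suc (Suc m)) a"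
    proof (rule tensor_partI)
      fix j assume j: "j < rank P (Suc (Suc m))"
      show "z' $ j \<in> monomial_ideal G"
        using ideal_mult_mem[OF ideal_monomial_ideal xpow_in_monomial_ideal[OF g(1)]] j
        by (simp add: z'_def mult.commute[of "xpow g"])
      fix b assume "b \<in> keys (z' $ j)"
      then have "b \<in> keys (xpow g * component (a - g) (shift P (Suc (Suc m)) j) (y $ j))"
        using j by (simp add: z'_def)
      then obtain g' c where "b = g' + c" "g' \<in> keys (xpow g :: ('n, 'k) mpoly)"
        "c \<in> keys (component (a - g) (shift P (Suc (Suc m)) j) (y $ j))"
        using keys_mult[of "xpow g" "component (a - g) (shift P (Suc (Suc m)) j) (y $ j)"] by blast
      then have "b = g + c" "c \<in> keys (component (a - g) (shift P (Suc (Suc m)) j) (y $ j))"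
        by simp_all
      then show "b + shift P (Suc (Suc m)) j = a"
        using keys_component exp_le_diff_add[OF g(2)] by (metis add.assoc add.commute)
    qed fact
    moreover have "z = diff P (Suc m) *\<^sub>v z'"
    proof (rule eq_vecI)
      fix l assume "l < dim_vec (diff P (Suc m) *\<^sub>v z')"
      then have l: "l < rank P (Suc m)" using diff_carrier[of "Suc m"] by simp
      have "(diff P (Suc m) *\<^sub>v z') $ l
          = (\<Sum>j<rank P (Suc (Suc m)). xpow g * (diff P (Suc m) $$ (l, j)
              * component (a - g) (shift P (Suc (Suc m)) j) (y $ j)))"
        unfolding mult_mat_vec_nth[OF diff_carrier z'_carrier l]
        by (rule sum.cong) (auto simp: z'_def ac_simps)
      also have "\<dots> = xpow g * component (a - g) (shift P (Suc m) l)
          (\<Sum>j<rank P (Suc (Suc m)). diff P (Suc m) $$ (l, j) * y $ j)"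
        unfolding component_sum sum_distrib_left
        by (rule sum.cong[OF refl]) (simp add: component_times[OF diff_homogeneous[OF l]])
      also have "\<dots> = xpow g * component (a - g) (shift P (Suc m) l) (w $ l)"
        unfolding y(2) mult_mat_vec_nth[OF diff_carrier y(1) l] ..
      also have "component (a - g) (shift P (Suc m) l) (w $ l) = w $ l"
      proof (rule component_homogeneous)
        fix b assume "b \<in> keys (w $ l)"
        then have "g + b \<in> keys (z $ l)" by (simp add: in_keys_iff lookup_w[OF l])
        from tensor_partD(3)[OF z_part l this]
        show "b + shift P (Suc m) l = a - g" by (metis add.assoc add_diff_cancel_left')
      qed
      finally show "z $ l = (diff P (Suc m) *\<^sub>v z') $ l" by (simp add: z_eq[OF l])
    qed (use diff_carrier[of "Suc m"] tensor_partD(1)[OF z_part] in simp)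
    ultimately show ?thesis unfolding tensor_boundaries_def by blast
  qed
qed

end

lemma Tor_nonzero_imp_two_generators:
  assumes "Tor_nonzero (Suc m) (monomial_ideal G :: ('n::finite, 'k::field) mpoly set) a"
  shows "\<exists>u\<in>G. \<exists>v\<in>G. u \<noteq> v \<and> u \<preceq> a \<and> v \<preceq> a"
proof (rule ccontr)
  assume "\<not> ?thesis"
  then have unique: "u = v" if "u \<in> G" "v \<in> G" "u \<preceq> a" "v \<preceq> a" for u v
    using that by blast
  have "tensor_cycles P (monomial_ideal G) (Suc m) a
      = tensor_boundaries P (monomial_ideal G) (Suc m) a"
    if "graded_free_resolution_of_K P" for P :: "('n, 'k) free_complex"
    using boundaries_subset_cycles[OF that ideal_monomial_ideal]
      cycles_subset_boundaries_if_unique_generator[OF that unique] by blast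
  with assms show False by (auto simp: Tor_nonzero_def)
qed

section \<open>An explicit multigraded resolution of the residue field\<close>

text \<open>
  The resolution below is the one whose strand in multidegree \<open>a\<close> is the augmented ordered chain
  complex of the full simplex on the variables that divide \<open>x\<^sup>a\<close>. Its basis in homological degree \<open>k\<close>
  consists of all lists of \<open>k\<close> variables, repetitions included, and the list \<open>t\<close> has as multidegree the
  squarefree exponent vector of \<open>set t\<close>. It is infinite and not minimal, but unlike the Koszul complex
  it has no orientation signs: the differential obeys \<open>d (i # t) = t - i # d t\<close> up to monomial factors,
  and prepending a variable \<open>i\<close> that divides \<open>x\<^sup>a\<close> is a contraction of the strand for \<open>a \<noteq> 0\<close>.
\<close>

abbreviation tuples :: "nat \<Rightarrow> 'n list set" where
  "tuples k \<equiv> {t. length t = k}"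

lemma finite_tuples [simp]: "finite (tuples k :: 'n::finite list set)"
  using finite_lists_length_eq[of "UNIV :: 'n set" k] by simp

lemma sum_tuples_Cons:
  fixes F :: "'n::finite list \<Rightarrow> 'a::comm_monoid_add"
  shows "(\<Sum>t\<in>tuples (Suc k). case t of [] \<Rightarrow> 0 | p # t' \<Rightarrow> if p = i then F t' else 0)
    = (\<Sum>t\<in>tuples k. F t)"
proof -
  have "(\<Sum>t\<in>tuples (Suc k). case t of [] \<Rightarrow> 0 | p # t' \<Rightarrow> if p = i then F t' else 0)
      = (\<Sum>t\<in>(#) i ` tuples k. case t of [] \<Rightarrow> 0 | p # t' \<Rightarrow> if p = i then F t' else 0)"
    by (rule sum.mono_neutral_right) (auto split: list.splits)
  also have "\<dots> = (\<Sum>t\<in>tuples k. F t)"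
    by (subst sum.reindex) (auto simp: inj_on_def)
  finally show ?thesis .
qed

lemma sum_tuples_1: "(\<Sum>t\<in>tuples (Suc 0). F t) = (\<Sum>p\<in>UNIV. F [p :: 'n::finite])"
proof -
  have "tuples (Suc 0) = range (\<lambda>p :: 'n. [p])"
    by (auto simp: length_Suc_conv)
  then show ?thesis
    by (simp add: sum.reindex inj_on_def)
qed

text \<open>
  The coefficient of the list \<open>s\<close> in the boundary of \<open>t\<close>, that is, the rule
  \<open>d (i # t) = t - i # d t\<close> read coefficientwise.
\<close>

fun incidence :: "'n list \<Rightarrow> 'n list \<Rightarrow> 'k::field" where
  "incidence s [] = 0"
| "incidence s (i # t) = (if s = t then 1 else 0)
     - (case s of [] \<Rightarrow> 0 | p # s' \<Rightarrow> if p = i then incidence s' t else 0)"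

lemma incidence_length: "incidence s t \<noteq> (0::'k::field) \<Longrightarrow> length t = Suc (length s)"
  by (induction t arbitrary: s) (auto split: list.splits if_splits)

lemma incidence_subset: "incidence s t \<noteq> (0::'k::field) \<Longrightarrow> set s \<subseteq> set t"
  by (induction t arbitrary: s) (auto split: list.splits if_splits)

text \<open>
  The rule \<open>d (i # t) = t - i # d t\<close> extended linearly to a combination of lists with coefficients \<open>F\<close>.
\<close>

lemma sum_incidence_Cons:
  fixes F :: "'n::finite list \<Rightarrow> 'k::field"
  shows "(\<Sum>t\<in>tuples k. incidence s (i # t) * F t) = (if length s = k then F s else 0)
    - (case s of [] \<Rightarrow> 0 | p # s' \<Rightarrow> if p = i then \<Sum>t\<in>tuples k. incidence s' t * F t else 0)"
proof -
  define c where "c t = (case s of [] \<Rightarrow> 0 | p # s' \<Rightarrow> if p = i then incidence s' t else (0::'k))" for t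
  have "(\<Sum>t\<in>tuples k. incidence s (i # t) * F t)
      = (\<Sum>t\<in>tuples k. (if t = s then F t else 0) - c t * F t)"
    by (rule sum.cong) (auto simp: left_diff_distrib c_def)
  also have "\<dots> = (if length s = k then F s else 0) - (\<Sum>t\<in>tuples k. c t * F t)"
    unfolding sum_subtractf by (simp add: sum.delta)
  also have "(\<Sum>t\<in>tuples k. c t * F t)
      = (case s of [] \<Rightarrow> 0 | p # s' \<Rightarrow> if p = i then \<Sum>t\<in>tuples k. incidence s' t * F t else 0)"
    by (cases s) (simp_all add: c_def)
  finally show ?thesis .
qed

text \<open>
  \<open>d (d (i # t)) = d t - d (i # d t) = d t - d t + i # d (d t)\<close>, whence \<open>d\<^sup>2 = 0\<close> by induction.
\<close>

lemma incidence_square: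
  "(\<Sum>s\<in>tuples k. incidence r s * incidence s t) = (0 :: 'k::field)" for t :: "'n::finite list"
proof (induction t arbitrary: r k)
  case (Cons i t)
  have "(\<Sum>s\<in>tuples k. incidence r s * incidence s (i # t))
    = (\<Sum>s\<in>tuples k. (if s = t then incidence r s else 0)
      - (case s of [] \<Rightarrow> 0
          | p # s' \<Rightarrow> if p = i then incidence r (i # s') * incidence s' t else (0::'k)))"
    by (rule sum.cong) (auto simp: right_diff_distrib split: list.splits)
  also have "\<dots> = (if length t = k then incidence r t else 0)
      - (\<Sum>s\<in>tuples k. case s of [] \<Rightarrow> 0
          | p # s' \<Rightarrow> if p = i then incidence r (i # s') * incidence s' t else (0::'k))"
    unfolding sum_subtractf by (simp add: sum.delta)
  also have "\<dots> = 0"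
  proof (cases k)
    case 0
    then show ?thesis by simp
  next
    case (Suc k')
    have "(\<Sum>s\<in>tuples k. case s of [] \<Rightarrow> 0
          | p # s' \<Rightarrow> if p = i then incidence r (i # s') * incidence s' t else (0::'k))
        = (\<Sum>s\<in>tuples k'. incidence r (i # s) * incidence s t)"
      unfolding Suc sum_tuples_Cons ..
    also have "\<dots> = (if length r = k' then incidence r t else 0)"
      unfolding sum_incidence_Cons Cons.IH by (simp split: list.split)
    also have "\<dots> = (if length t = k then incidence r t else 0)"
      using incidence_length[of r t, where 'k = 'k] unfolding Suc
      by (cases "incidence r t = (0::'k)") simp_all
    finally show ?thesis by simp
  qed
  finally show ?case .
qed simp

definition face :: "'n list \<Rightarrow> ('n \<Rightarrow>\<^sub>0 nat)" where
  "face t = (\<Sum>i\<in>set t. single i 1)"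

lemma lookup_face: "lookup (face t) i = (if i \<in> set t then 1 else 0)"
proof -
  have "lookup (face t) i = (\<Sum>j\<in>set t. if j = i then 1 else 0)"
    unfolding face_def lookup_sum by (rule sum.cong) (auto simp: lookup_single when_def)
  then show ?thesis by (simp add: sum.delta)
qed

lemma face_Nil [simp]: "face [] = 0"
  by (simp add: face_def)

lemma face_mono: "set s \<subseteq> set t \<Longrightarrow> face s \<preceq> face t"
  by (auto simp: exp_le_def lookup_face)

lemma face_le_iff: "face t \<preceq> a \<longleftrightarrow> set t \<subseteq> keys a"
  by (auto simp: exp_le_def lookup_face in_keys_iff Suc_le_eq subset_iff)

text \<open>
  An element of the free module on lists is a function \<open>f\<close> that gives the polynomial coefficient of each
  list. Its part of multidegree \<open>a\<close> is a combination of the elements \<open>xpow (a - face t)\<close> times \<open>t\<close>, and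
  \<open>strand f a t\<close> is the scalar in front of that basis element.
\<close>

definition strand :: "('n list \<Rightarrow> ('n, 'k::field) mpoly) \<Rightarrow> ('n \<Rightarrow>\<^sub>0 nat) \<Rightarrow> 'n list \<Rightarrow> 'k" where
  "strand f a t = (if face t \<preceq> a then lookup (f t) (a - face t) else 0)"

lemma strand_add_face: "strand f (b + face t) t = lookup (f t) b"
  by (simp add: strand_def)

lemma eq_if_strands_eq: "(\<And>a. strand f a t = strand g a t) \<Longrightarrow> f t = g t"
  by (rule poly_mapping_eqI) (metis strand_add_face)

definition boundary :: "('n list \<Rightarrow> ('n, 'k::field) mpoly) \<Rightarrow> 'n list \<Rightarrow> ('n, 'k) mpoly" where
  "boundary f s = (\<Sum>t\<in>tuples (Suc (length s)). single (face t - face s) (incidence s t) * f t)"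

text \<open>
  On strands the monomial factors disappear and the differential becomes the scalar incidence matrix,
  so that identities between polynomial matrices reduce to identities between scalars.
\<close>

lemma strand_boundary:
  fixes f :: "'n list \<Rightarrow> ('n, 'k::field) mpoly"
  shows "strand (boundary f) a s = (\<Sum>t\<in>tuples (Suc (length s)). incidence s t * strand f a t)"
proof -
  have coeff: "(if face s \<preceq> a then lookup (single (face t - face s) (incidence s t) * f t) (a - face s) else 0)
      = incidence s t * strand f a t" for t
  proof (cases "incidence s t = (0::'k)")
    case False
    then have st: "face s \<preceq> face t"
      by (rule face_mono[OF incidence_subset])
    have le: "face t - face s \<preceq> a - face s \<longleftrightarrow> face t \<preceq> a" if sa: "face s \<preceq> a"
    proof
      assume "face t - face s \<preceq> a - face s"
      then show "face t \<preceq> a"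
        using exp_le_add_mono[OF _ exp_le_refl] exp_le_diff_add[OF st] exp_le_diff_add[OF sa] by metis
    next
      assume "face t \<preceq> a"
      then show "face t - face s \<preceq> a - face s"
        by (simp add: exp_le_def lookup_minus diff_le_mono)
    qed
    have "a - face s - (face t - face s) = a - face t"
      by (metis st add.commute diff_diff_eq exp_le_diff_add)
    then show ?thesis
      using le exp_le_trans[OF st] by (auto simp: strand_def lookup_single_times)
  qed simp
  have "strand (boundary f) a s = (\<Sum>t\<in>tuples (Suc (length s)).
      if face s \<preceq> a then lookup (single (face t - face s) (incidence s t) * f t) (a - face s) else 0)"
    by (simp add: strand_def boundary_def lookup_sum)
  then show ?thesis unfolding coeff .
qed

lemma boundary_boundary: "boundary (boundary f) r = 0" for r :: "'n::finite list"
proof -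
  have "strand (boundary (boundary f)) a r = strand (\<lambda>_. 0) a r" for a
  proof -
    let ?k = "length r"
    have "strand (boundary (boundary f)) a r
      = (\<Sum>s\<in>tuples (Suc ?k). \<Sum>t\<in>tuples (Suc (Suc ?k)). incidence r s * incidence s t * strand f a t)"
      unfolding strand_boundary sum_distrib_left by (intro sum.cong) (auto simp: mult.assoc)
    also have "\<dots> = (\<Sum>t\<in>tuples (Suc (Suc ?k)).
        (\<Sum>s\<in>tuples (Suc ?k). incidence r s * incidence s t) * strand f a t)"
      by (subst sum.swap) (simp only: sum_distrib_right)
    also have "\<dots> = 0" by (simp only: incidence_square) simp
    finally show ?thesis by (simp add: strand_def)
  qed
  from eq_if_strands_eq[of "boundary (boundary f)" r "\<lambda>_. 0", OF this] show ?thesis .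
qed

text \<open>
  A variable dividing \<open>x\<^sup>a\<close>, the cone point of the simplex in multidegree \<open>a\<close>.
\<close>

definition apex :: "('n \<Rightarrow>\<^sub>0 nat) \<Rightarrow> 'n" where
  "apex a = (SOME i. i \<in> keys a)"

lemma apex_in_keys: "a \<noteq> 0 \<Longrightarrow> apex a \<in> keys a"
  unfolding apex_def by (rule someI_ex) (metis in_keys_iff lookup_zero poly_mapping_eqI)

text \<open>
  The contraction: on the strand of multidegree \<open>a\<close>, a list \<open>s\<close> is sent to \<open>apex a # s\<close>. The cone point
  depends on the multidegree, so the map is only \<open>K\<close>-linear, which suffices for exactness. In the
  coefficient of \<open>t = p # s\<close>, the monomial with exponent \<open>b\<close> has multidegree \<open>b + face t\<close>, and it comes
  from the monomial of \<open>f s\<close> with exponent \<open>b + (face t - face s)\<close>.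
\<close>

definition cone :: "('n list \<Rightarrow> ('n, 'k::field) mpoly) \<Rightarrow> 'n list \<Rightarrow> ('n, 'k) mpoly" where
  "cone f t = (case t of [] \<Rightarrow> 0
     | p # s \<Rightarrow> Poly_Mapping.mapp (\<lambda>b c. if apex (b + face t) = p then c else 0)
         (Poly_Mapping.map_key ((+) (face t - face s)) (f s)))"

lemma strand_cone:
  assumes "a \<noteq> 0"
  shows "strand (cone f) a t = (case t of [] \<Rightarrow> 0 | p # s \<Rightarrow> if p = apex a then strand f a s else 0)"
proof (cases t)
  case (Cons p s)
  have st: "face s \<preceq> face t" by (rule face_mono) (auto simp: Cons)
  have shift: "face t - face s + (a - face t) = a - face s" if "face t \<preceq> a"
    using st that unfolding exp_le_def
    by (intro poly_mapping_eqI) (simp add: lookup_add lookup_minus)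
  have "strand (cone f) a t = (if face t \<preceq> a \<and> p = apex a then lookup (f s) (a - face s) else 0)"
    using shift by (auto simp: strand_def cone_def Cons lookup_mapp map_key.rep_eq when_def
        in_keys_iff exp_le_diff_add)
  also have "\<dots> = (if p = apex a then strand f a s else 0)"
    using apex_in_keys[OF assms] by (auto simp: strand_def face_le_iff Cons)
  finally show ?thesis by (simp add: Cons)
qed (simp add: strand_def cone_def)

text \<open>
  The homotopy identity \<open>d h + h d = 1\<close> in nonzero multidegrees.
\<close>

lemma cone_homotopy:
  fixes s :: "'n::finite list"
  assumes "a \<noteq> 0"
  shows "strand (boundary (cone f)) a s = strand f a s - strand (cone (boundary f)) a s"
proof -
  have "strand (boundary (cone f)) a s = (\<Sum>t\<in>tuples (Suc (length s)).
      case t of [] \<Rightarrow> 0 | p # t' \<Rightarrow> if p = apex a then incidence s (apex a # t') * strand f a t' else 0)"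
    unfolding strand_boundary strand_cone[OF assms]
    by (rule sum.cong) (auto split: list.splits)
  also have "\<dots> = strand f a s - strand (cone (boundary f)) a s"
    unfolding sum_tuples_Cons sum_incidence_Cons strand_cone[OF assms] strand_boundary
    by (auto split: list.splits)
  finally show ?thesis .
qed

text \<open>
  Multidegree \<open>0\<close> is harmless here, since the strand of multidegree \<open>0\<close> contains only the empty list.
\<close>

lemma boundary_cone_Cons:
  fixes s :: "'n::finite list"
  assumes "boundary f s = 0"
  shows "boundary (cone f) (p # s) = f (p # s)"
proof (rule eq_if_strands_eq)
  fix a
  show "strand (boundary (cone f)) a (p # s) = strand f a (p # s)"
  proof (cases "a = 0")
    case True
    then have "\<not> face t \<preceq> a" if "t \<noteq> []" for t :: "'n list"
      using that by (simp add: face_le_iff)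
    then show ?thesis by (simp add: strand_def)
  next
    case False
    have "strand (cone (boundary f)) a (p # s) = 0"
      unfolding strand_cone[OF False] using assms by (simp add: strand_def)
    then show ?thesis by (simp add: cone_homotopy[OF False])
  qed
qed

lemma boundary_Nil_const: "lookup (boundary f ([] :: 'n::finite list)) 0 = 0"
proof -
  have "strand f 0 [p] = 0" for p by (simp add: strand_def face_le_iff)
  then have "strand (boundary f) 0 [] = 0"
    unfolding strand_boundary by (simp add: sum_tuples_1)
  then show ?thesis using strand_add_face[of "boundary f" 0 "[]"] by simp
qed

text \<open>
  At the empty list multidegree \<open>0\<close> has to be treated separately: it carries the homology \<open>K\<close> of the
  complex, which is what the vanishing of the constant term excludes.
\<close>

lemma boundary_cone_Nil:
  fixes f :: "'n::finite list \<Rightarrow> ('n, 'k::field) mpoly"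
  assumes "lookup (f []) 0 = 0"
  shows "boundary (cone f) [] = f []"
proof (rule eq_if_strands_eq)
  fix a
  show "strand (boundary (cone f)) a [] = strand f a []"
  proof (cases "a = 0")
    case True
    have "strand g 0 [] = lookup (g []) 0" for g :: "'n list \<Rightarrow> ('n, 'k) mpoly"
      by (simp add: strand_def)
    then show ?thesis using assms boundary_Nil_const by (simp add: True)
  next
    case False
    then show ?thesis by (simp add: cone_homotopy[OF False]) (simp add: strand_cone[OF False])
  qed
qed

text \<open>
  An enumeration of the basis, since the bases of the modules of a complex are indexed by numbers.
\<close>

definition tuple :: "nat \<Rightarrow> nat \<Rightarrow> 'n::finite list" where
  "tuple k = (SOME h. bij_betw h {..<card (tuples k :: 'n list set)} (tuples k))"

lemma bij_tuple:
  "bij_betw (tuple k) {..<card (tuples k :: 'n::finite list set)} (tuples k :: 'n list set)"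
proof -
  have "\<exists>h. bij_betw h {..<card (tuples k :: 'n list set)} (tuples k :: 'n list set)"
    using ex_bij_betw_nat_finite[OF finite_tuples[of k, where 'n = 'n]] by (simp add: atLeast0LessThan)
  then show ?thesis unfolding tuple_def by (rule someI_ex)
qed

definition simplex_resolution :: "('n::finite, 'k::field) free_complex" where
  "simplex_resolution =
     \<lparr>rank = (\<lambda>k. card (tuples k :: 'n list set)),
      shift = (\<lambda>k j. face (tuple k j :: 'n list)),
      diff = (\<lambda>k. mat (card (tuples k :: 'n list set)) (card (tuples (Suc k) :: 'n list set))
        (\<lambda>(l, j). single (face (tuple (Suc k) j :: 'n list) - face (tuple k l :: 'n list))
           (incidence (tuple k l :: 'n list) (tuple (Suc k) j)))),
      aug = vec 1 (\<lambda>_. 1)\<rparr>"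

definition vec_of :: "nat \<Rightarrow> ('n::finite list \<Rightarrow> ('n, 'k::field) mpoly) \<Rightarrow> ('n, 'k) mpoly vec" where
  "vec_of k f = vec (card (tuples k :: 'n list set)) (\<lambda>j. f (tuple k j))"

lemma tuple_image:
  "tuple k ` {..<card (tuples k :: 'n::finite list set)} = (tuples k :: 'n list set)"
  by (rule bij_betw_imp_surj_on[OF bij_tuple])

lemma tuple_length: "j < card (tuples k :: 'n::finite list set) \<Longrightarrow> length (tuple k j :: 'n list) = k"
  using tuple_image[of k, where 'n = 'n] by blast

lemma tuple_surj:
  fixes t :: "'n::finite list"
  obtains j where "j < card (tuples (length t) :: 'n list set)" "tuple (length t) j = t"
proof -
  have "t \<in> tuple (length t) ` {..<card (tuples (length t) :: 'n list set)}"
    unfolding tuple_image by simp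
  then show ?thesis using that by auto
qed

lemma vec_of_eq_iff:
  "vec_of k f = vec_of k g \<longleftrightarrow> (\<forall>t :: 'n::finite list. length t = k \<longrightarrow> f t = g t)"
proof
  assume eq: "vec_of k f = vec_of k g"
  show "\<forall>t. length t = k \<longrightarrow> f t = g t"
  proof (intro allI impI)
    fix t :: "'n list" assume "length t = k"
    then obtain j where j: "j < card (tuples k :: 'n list set)" "tuple k j = t"
      using tuple_surj by metis
    have "vec_of k f $ j = vec_of k g $ j" using eq by simp
    then show "f t = g t" using j by (simp add: vec_of_def)
  qed
qed (auto simp: vec_of_def tuple_length intro!: eq_vecI)

lemma vec_of_carrier: "vec_of k f \<in> carrier_vec (rank (simplex_resolution :: ('n::finite, 'k::field) free_complex) k)"
  for f :: "'n::finite list \<Rightarrow> ('n, 'k::field) mpoly"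
  by (simp add: vec_of_def simplex_resolution_def)

lemma vec_of_surj:
  fixes v :: "('n::finite, 'k::field) mpoly vec"
  assumes "v \<in> carrier_vec (rank (simplex_resolution :: ('n, 'k) free_complex) k)"
  obtains f where "v = vec_of k f"
proof
  show "v = vec_of k (\<lambda>t. v $ the_inv_into {..<card (tuples k :: 'n list set)} (tuple k) t)"
    using assms bij_betw_imp_inj_on[OF bij_tuple[of k, where 'n = 'n]]
    by (intro eq_vecI) (auto simp: vec_of_def simplex_resolution_def the_inv_into_f_f)
qed

lemma diff_vec_of:
  fixes f :: "'n::finite list \<Rightarrow> ('n, 'k::field) mpoly"
  shows "diff simplex_resolution k *\<^sub>v vec_of (Suc k) f = vec_of k (boundary f)"
proof (rule eq_vecI)
  fix l assume "l < dim_vec (vec_of k (boundary f))"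
  then have l: "l < card (tuples k :: 'n list set)" by (simp add: vec_of_def)
  let ?s = "tuple k l :: 'n list"
  have s: "length ?s = k" using l by (rule tuple_length)
  have "(diff simplex_resolution k *\<^sub>v vec_of (Suc k) f) $ l
      = (\<Sum>j<card (tuples (Suc k) :: 'n list set).
          single (face (tuple (Suc k) j) - face ?s) (incidence ?s (tuple (Suc k) j)) * f (tuple (Suc k) j))"
    using l by (subst mult_mat_vec_nth[of _ "card (tuples k :: 'n list set)" "card (tuples (Suc k) :: 'n list set)"])
      (auto simp: simplex_resolution_def vec_of_def intro!: sum.cong)
  also have "\<dots> = boundary f ?s"
    unfolding boundary_def s by (rule sum.reindex_bij_betw[OF bij_tuple])
  finally show "(diff simplex_resolution k *\<^sub>v vec_of (Suc k) f) $ l = vec_of k (boundary f) $ l"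
    using l by (simp add: vec_of_def)
qed (simp add: simplex_resolution_def vec_of_def)

lemma rank_0: "rank (simplex_resolution :: ('n::finite, 'k::field) free_complex) 0 = 1"
proof -
  have "tuples 0 = {[] :: 'n list}" by auto
  then show ?thesis by (simp add: simplex_resolution_def)
qed

lemma augmentation_vec_of:
  fixes f :: "'n::finite list \<Rightarrow> ('n, 'k::field) mpoly"
  shows "augmentation simplex_resolution (vec_of 0 f) = lookup (f []) 0"
proof -
  have "vec_of 0 f = vec 1 (\<lambda>_. f [])"
    unfolding vec_of_def using rank_0[where 'n = 'n] tuple_length[where 'n = 'n, of _ 0]
    by (auto simp: simplex_resolution_def intro!: eq_vecI)
  then show ?thesis by (simp add: augmentation_def simplex_resolution_def scalar_prod_def)
qed

lemma resolution_simplex: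
  "graded_free_resolution_of_K (simplex_resolution :: ('n::finite, 'k::field) free_complex)"
    (is "graded_free_resolution_of_K ?Q")
  unfolding graded_free_resolution_of_K_def
proof (intro conjI allI impI ballI)
  show "aug ?Q \<in> carrier_vec (rank ?Q 0)"
    unfolding rank_0 by (simp add: simplex_resolution_def)
  show "shift ?Q 0 j = 0" if "j < rank ?Q 0" for j
    using that tuple_length[of j 0, where 'n = 'n] by (simp add: simplex_resolution_def)
  show "diff ?Q k \<in> carrier_mat (rank ?Q k) (rank ?Q (Suc k))" for k
    by (simp add: simplex_resolution_def)
  show "b + shift ?Q k l = shift ?Q (Suc k) j"
    if "l < rank ?Q k" "j < rank ?Q (Suc k)" "b \<in> keys (diff ?Q k $$ (l, j))" for k l j b
  proof -
    have "incidence (tuple k l :: 'n list) (tuple (Suc k) j) \<noteq> (0 :: 'k)"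
      "b = face (tuple (Suc k) j) - face (tuple k l)"
      using that by (auto simp: simplex_resolution_def split: if_splits)
    then show ?thesis
      using exp_le_diff_add[OF face_mono[OF incidence_subset]]
      by (simp add: simplex_resolution_def)
  qed
  show "augmentation ?Q ` carrier_vec (rank ?Q 0) = UNIV"
  proof -
    have "c \<in> augmentation ?Q ` carrier_vec (rank ?Q 0)" for c
      using augmentation_vec_of[of "\<lambda>_ :: 'n list. single 0 c"]
        vec_of_carrier[of 0 "\<lambda>_ :: 'n list. single 0 c"]
      by (metis imageI lookup_single_eq)
    then show ?thesis by blast
  qed
  show "{v \<in> carrier_vec (rank ?Q 0). augmentation ?Q v = 0}
    = (\<lambda>w. diff ?Q 0 *\<^sub>v w) ` carrier_vec (rank ?Q 1)" (is "?L = ?R")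
  proof (intro equalityI subsetI)
    fix v assume "v \<in> ?L"
    then obtain f where v: "v = vec_of 0 f" "augmentation ?Q (vec_of 0 f) = 0"
      using vec_of_surj by blast
    then have "boundary (cone f) [] = f []"
      by (intro boundary_cone_Nil) (simp add: augmentation_vec_of)
    then have "v = diff ?Q 0 *\<^sub>v vec_of 1 (cone f)"
      unfolding v One_nat_def diff_vec_of vec_of_eq_iff by simp
    then show "v \<in> ?R" using vec_of_carrier by blast
  next
    fix v assume "v \<in> ?R"
    then obtain f where "v = diff ?Q 0 *\<^sub>v vec_of 1 f"
      using vec_of_surj by blast
    then have v: "v = vec_of 0 (boundary f)"
      unfolding One_nat_def diff_vec_of .
    then show "v \<in> ?L"
      using vec_of_carrier by (simp add: augmentation_vec_of boundary_Nil_const)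
  qed
  show "mat_kernel (diff ?Q k) = (\<lambda>w. diff ?Q (Suc k) *\<^sub>v w) ` carrier_vec (rank ?Q (Suc (Suc k)))"
    (is "?L = ?R") for k
  proof -
    have diff: "diff ?Q k \<in> carrier_mat (rank ?Q k) (rank ?Q (Suc k))"
      by (simp add: simplex_resolution_def)
    have zero: "0\<^sub>v (rank ?Q k) = vec_of k (\<lambda>_. 0 :: ('n, 'k) mpoly)"
      by (auto simp: vec_of_def simplex_resolution_def)
    show ?thesis
    proof (intro equalityI subsetI)
      fix v assume "v \<in> ?L"
      then have "v \<in> carrier_vec (rank ?Q (Suc k))" "diff ?Q k *\<^sub>v v = 0\<^sub>v (rank ?Q k)"
        using mat_kernelD[OF diff] by blast+
      then obtain f where v: "v = vec_of (Suc k) f" "vec_of k (boundary f) = vec_of k (\<lambda>_. 0)"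
        unfolding zero using vec_of_surj diff_vec_of by metis
      have "boundary (cone f) t = f t" if "length t = Suc k" for t
        using that v(2) boundary_cone_Cons[of f]
        by (auto simp: vec_of_eq_iff length_Suc_conv)
      then have "v = diff ?Q (Suc k) *\<^sub>v vec_of (Suc (Suc k)) (cone f)"
        unfolding v diff_vec_of vec_of_eq_iff by simp
      then show "v \<in> ?R" using vec_of_carrier by blast
    next
      fix v assume "v \<in> ?R"
      then obtain f where "v = diff ?Q (Suc k) *\<^sub>v vec_of (Suc (Suc k)) f"
        using vec_of_surj by blast
      then have v: "v = vec_of (Suc k) (boundary f)"
        unfolding diff_vec_of .
      have "diff ?Q k *\<^sub>v v = 0\<^sub>v (rank ?Q k)"
        unfolding v diff_vec_of zero vec_of_eq_iff by (simp add: boundary_boundary)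
      then show "v \<in> ?L"
        using mat_kernelI[OF diff] vec_of_carrier v by blast
    qed
  qed
qed

section \<open>The first homological shift ideal of a monomial ideal\<close>

definition total_degree :: "('n::finite \<Rightarrow>\<^sub>0 nat) \<Rightarrow> nat" where
  "total_degree a = (\<Sum>i\<in>UNIV. lookup a i)"

lemma total_degree_add: "total_degree (a + b) = total_degree a + total_degree b"
  by (simp add: total_degree_def lookup_add sum.distrib)

lemma total_degree_single: "total_degree (single i c) = c"
  by (simp add: total_degree_def lookup_single when_def)

lemma exp_le_total_degree_eq: 
  assumes "u \<preceq> v" "total_degree u = total_degree v"
  shows "u = v"
proof -
  obtain c where v: "v = u + c" using assms(1) exp_le_iff_add by blast
  then have "total_degree c = 0" using assms(2) by (simp add: total_degree_add)
  then have "lookup c i = 0" for i by (simp add: total_degree_def)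
  then have "c = 0" by (simp add: poly_mapping_eqI)
  then show ?thesis by (simp add: v)
qed

text \<open>
  The boundary of the edge \<open>[q, r]\<close> is \<open>[r] - [q]\<close>, so the sum of the coefficients over a vertex set \<open>C\<close>
  kills it unless exactly one of the end points lies in \<open>C\<close>.
\<close>

lemma sum_incidence_pair:
  assumes "finite C"
  shows "(\<Sum>p\<in>C. incidence [p] [q, r]) = ((if r \<in> C then 1 else 0) - (if q \<in> C then 1 else 0) :: 'k::field)"
proof -
  have "(\<Sum>p\<in>C. incidence [p] [q, r]) = (\<Sum>p\<in>C. (if p = r then 1 else 0) - (if p = q then 1 else (0::'k)))"
    by (rule sum.cong) auto
  then show ?thesis using assms by (simp add: sum_subtractf sum.delta)
qed

definition common_multiples :: "('n \<Rightarrow>\<^sub>0 nat) set \<Rightarrow> ('n \<Rightarrow>\<^sub>0 nat) set" where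
  "common_multiples G = {a. \<exists>u\<in>G. \<exists>v\<in>G. u \<noteq> v \<and> u \<preceq> a \<and> v \<preceq> a}"

text \<open>
  Let \<open>u\<close> and \<open>v\<close> be distinct generators dividing \<open>x\<^sup>b\<close>. By minimality of \<open>b\<close>, each monomial \<open>x\<^sup>b / x\<^sub>p\<close>
  in the ideal is a multiple of exactly one generator, and this generator is the same for \<open>p\<close> and \<open>q\<close>
  as soon as \<open>x\<^sup>b\<close> divided by \<open>x\<^sub>p x\<^sub>q\<close> (by \<open>x\<^sub>p\<close> if \<open>p = q\<close>) lies in the ideal. So the variables \<open>p\<close> that
  belong to \<open>u\<close> form a set \<open>C\<close> such that every boundary has coefficient sum \<open>0\<close> over \<open>C\<close>. For
  \<open>i\<close> belonging to \<open>u\<close> and \<open>j\<close> belonging to \<open>v\<close>, the cycle \<open>[i] - [j]\<close> has sum \<open>1\<close>.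
\<close>

lemma Tor_1_nonzero_minimal_common_multiple:
  fixes G :: "('n::finite \<Rightarrow>\<^sub>0 nat) set"
  assumes antichain: "\<And>u v. u \<in> G \<Longrightarrow> v \<in> G \<Longrightarrow> u \<preceq> v \<Longrightarrow> u = v"
    and b: "b \<in> common_multiples G"
    and minimal: "\<And>c. c \<in> common_multiples G \<Longrightarrow> c \<preceq> b \<Longrightarrow> c = b"
  shows "Tor_nonzero 1 (monomial_ideal G :: ('n, 'k::field) mpoly set) b"
proof -
  let ?Q = "simplex_resolution :: ('n, 'k) free_complex"
  let ?J = "monomial_ideal G :: ('n, 'k) mpoly set"
  obtain u v where uv: "u \<in> G" "v \<in> G" "u \<noteq> v" "u \<preceq> b" "v \<preceq> b"
    using b by (auto simp: common_multiples_def)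
  have face_pos: "b - face [p] \<noteq> b" if "face [p] \<preceq> b" for p :: 'n
  proof
    assume "b - face [p] = b"
    then have "b + face [p] = b + 0" using exp_le_diff_add[OF that] by simp
    then have "face [p] = 0" by (rule add_left_imp_eq)
    then have "lookup (face [p]) p = 0" by simp
    then show False by (simp add: lookup_face)
  qed
  have diff_le: "b - c \<preceq> b" for c by (simp add: exp_le_def lookup_minus)
  have unique: "g = h" if "g \<in> G" "h \<in> G" "face [p] \<preceq> b" "g \<preceq> b - face [p]" "h \<preceq> b - face [p]" for g h p
    using minimal[of "b - face [p]"] diff_le face_pos that by (auto simp: common_multiples_def)
  define C where "C = {p. face [p] \<preceq> b \<and> u \<preceq> b - face [p]}"
  \<comment> \<open>A generator g other than b divides xpow (b - face [p]) for some p, which provides the two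
    vertices i and j.\<close>
  have proper: "\<exists>p. face [p] \<preceq> b \<and> g \<preceq> b - face [p]" if g: "g \<in> G" "g \<preceq> b" "g \<noteq> b" for g
  proof -
    obtain c where c: "b = g + c" using g(2) exp_le_iff_add by blast
    then have "c \<noteq> 0" using g(3) by auto
    then obtain p where "p \<in> keys c" using apex_in_keys by blast
    then have "face [p] \<preceq> c" by (simp add: face_le_iff)
    then obtain d where "c = face [p] + d" using exp_le_iff_add by blast
    then have "b = face [p] + (g + d)" by (simp add: c ac_simps)
    then show ?thesis by (metis add_diff_cancel_left' exp_le_add_right)
  qed
  have "u \<noteq> b" "v \<noteq> b" using antichain uv by metis+
  then obtain i j where i: "face [i] \<preceq> b" "u \<preceq> b - face [i]" and j: "face [j] \<preceq> b" "v \<preceq> b - face [j]"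
    using proper uv by meson
  have iC: "i \<in> C" using i by (simp add: C_def)
  have jC: "j \<notin> C" using unique[of u v j] uv j by (auto simp: C_def)
  then have ij: "i \<noteq> j" using iC by blast
  define f :: "'n list \<Rightarrow> ('n, 'k) mpoly" where
    "f t = (if t = [i] then xpow (b - face [i]) else if t = [j] then - xpow (b - face [j]) else 0)" for t
  have f_mem: "f t \<in> ?J" for t
  proof -
    have "xpow (b - face [i]) \<in> ?J" "xpow (b - face [j]) \<in> ?J"
      using i j uv by (auto simp: xpow_in_monomial_ideal_iff)
    then show ?thesis
      using ideal_uminus_mem[OF ideal_monomial_ideal[of G, where 'k = 'k]]
        ideal_zero_mem[OF ideal_monomial_ideal[of G, where 'k = 'k]]
      by (simp add: f_def)
  qed
  have f_keys: "c + face t = b" if "c \<in> keys (f t)" for c t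
    using that i j exp_le_diff_add by (auto simp: f_def split: if_splits)
  have strand_f: "strand f a [p] = (if a = b then (if p = i then 1 else 0) - (if p = j then 1 else 0) else 0)"
    for a p
  proof (cases "a = b")
    case True
    then show ?thesis
      using i(1) j(1) ij by (auto simp: strand_def f_def xpow_def)
  next
    case False
    then have "a - face [p] \<notin> keys (f [p])" if "face [p] \<preceq> a"
      using f_keys[of "a - face [p]" "[p]"] exp_le_diff_add[OF that] by auto
    then show ?thesis using False by (auto simp: strand_def in_keys_iff)
  qed
  have "boundary f [] = 0"
  proof -
    have "strand (boundary f) a [] = strand (\<lambda>_. 0) a []" for a
    proof -
      have "strand (boundary f) a [] = (\<Sum>p\<in>UNIV. strand f a [p])"
        unfolding strand_boundary by (simp add: sum_tuples_1)
      also have "\<dots> = 0"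
        unfolding strand_f by (cases "a = b") (simp_all add: sum_subtractf sum.delta)
      finally show ?thesis by (simp add: strand_def)
    qed
    from eq_if_strands_eq[of "boundary f" "[]" "\<lambda>_. 0", OF this] show ?thesis .
  qed
  then have "diff ?Q 0 *\<^sub>v vec_of 1 f = vec_of 0 (\<lambda>_. 0)"
    unfolding One_nat_def diff_vec_of vec_of_eq_iff by simp
  also have "\<dots> = 0\<^sub>v (rank ?Q 0)"
    by (auto simp: vec_of_def simplex_resolution_def)
  finally have "diff ?Q 0 *\<^sub>v vec_of 1 f = 0\<^sub>v (rank ?Q 0)" .
  moreover have "vec_of 1 f \<in> tensor_part ?Q ?J 1 b"
    using f_mem f_keys
    by (intro tensor_partI vec_of_carrier) (simp_all add: simplex_resolution_def vec_of_def)
  ultimately have cycle: "vec_of 1 f \<in> tensor_cycles ?Q ?J 1 b"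
    by (simp add: tensor_cycles_def)
  have "vec_of 1 f \<notin> tensor_boundaries ?Q ?J 1 b"
  proof
    assume "vec_of 1 f \<in> tensor_boundaries ?Q ?J 1 b"
    then obtain w where w: "w \<in> tensor_part ?Q ?J 2 b" "vec_of 1 f = diff ?Q 1 *\<^sub>v w"
      by (auto simp: tensor_boundaries_def numeral_2_eq_2)
    then obtain g where g: "w = vec_of 2 g"
      using vec_of_surj tensor_partD(1) by metis
    have g_mem: "g t \<in> ?J" if t: "length t = 2" for t
    proof -
      obtain l where l: "l < card (tuples 2 :: 'n list set)" "tuple 2 l = t"
        using tuple_surj t by metis
      then have "w $ l \<in> ?J"
        using tensor_partD(2)[OF w(1)] by (simp add: simplex_resolution_def)
      then show ?thesis using l by (simp add: g vec_of_def)
    qed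
    have "vec_of 1 f = vec_of 1 (boundary g)"
      using w(2) diff_vec_of[of 1 g] by (simp add: g numeral_2_eq_2)
    then have f_eq: "strand f b [p] = strand (boundary g) b [p]" for p
      by (simp add: vec_of_eq_iff strand_def)
    \<comment> \<open>An edge that occurs in a chain with entries in the ideal does not leave C.\<close>
    have same_side: "q \<in> C \<longleftrightarrow> r \<in> C" if nz: "strand g b [q, r] \<noteq> 0" for q r
    proof -
      have le: "face [q, r] \<preceq> b" and "b - face [q, r] \<in> keys (g [q, r])"
        using nz by (auto simp: strand_def in_keys_iff split: if_splits)
      then obtain h where h: "h \<in> G" "h \<preceq> b - face [q, r]"
        using g_mem[of "[q, r]"] by (auto simp: monomial_ideal_def)
      have "face [p] \<preceq> b \<and> h \<preceq> b - face [p]" if "p \<in> {q, r}" for p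
      proof -
        have "face [p] \<preceq> face [q, r]" using that by (intro face_mono) auto
        moreover from this have "b - face [q, r] \<preceq> b - face [p]"
          by (simp add: exp_le_def lookup_minus diff_le_mono2)
        ultimately show ?thesis using le h(2) exp_le_trans by blast
      qed
      then have "p \<in> C \<longleftrightarrow> u = h" if "p \<in> {q, r}" for p
        using that unique[OF uv(1) h(1)] unfolding C_def by blast
      then show ?thesis by blast
    qed
    have "(1 :: 'k) = (\<Sum>p\<in>C. strand f b [p])"
      using iC jC by (simp add: strand_f sum_subtractf sum.delta)
    also have "\<dots> = (\<Sum>p\<in>C. \<Sum>t\<in>tuples 2. incidence [p] t * strand g b t)"
      unfolding f_eq strand_boundary by (simp add: numeral_2_eq_2)
    also have "\<dots> = (\<Sum>t\<in>tuples 2. (\<Sum>p\<in>C. incidence [p] t) * strand g b t)"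
      by (subst sum.swap) (simp only: sum_distrib_right)
    also have "\<dots> = 0"
    proof (rule sum.neutral, rule ballI)
      fix t :: "'n list" assume "t \<in> tuples 2"
      then obtain q r where t: "t = [q, r]" by (auto simp: numeral_2_eq_2 length_Suc_conv)
      show "(\<Sum>p\<in>C. incidence [p] t) * strand g b t = 0"
        using same_side[of q r] unfolding t by (subst sum_incidence_pair) auto
    qed
    finally show False by simp
  qed
  with cycle show ?thesis
    unfolding Tor_nonzero_def using resolution_simplex by blast
qed

lemma monomial_ideal_mono:
  assumes "\<And>a. a \<in> A \<Longrightarrow> \<exists>b\<in>B. b \<preceq> a"
  shows "monomial_ideal A \<subseteq> monomial_ideal B"
  using assms exp_le_trans unfolding monomial_ideal_def by blast

text \<open>
  The first homological shift ideal of a monomial ideal is generated by the common multiples of two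
  distinct minimal generators; the hypothesis says that \<open>G\<close> is a minimal system of generators. A minimal
  common multiple has nonzero Tor, and conversely nonzero Tor requires two generators below \<open>a\<close>.
\<close>

theorem HS_1_monomial_ideal:
  fixes G :: "('n::finite \<Rightarrow>\<^sub>0 nat) set"
  assumes antichain: "\<And>u v. u \<in> G \<Longrightarrow> v \<in> G \<Longrightarrow> u \<preceq> v \<Longrightarrow> u = v"
  shows "HS 1 (monomial_ideal G) = (monomial_ideal (common_multiples G) :: ('n, 'k::field) mpoly set)"
proof -
  let ?T = "{a. Tor_nonzero 1 (monomial_ideal G :: ('n, 'k) mpoly set) a}"
  have "HS 1 (monomial_ideal G) = (monomial_ideal ?T :: ('n, 'k) mpoly set)"
    unfolding HS_def using genideal_xpow[of ?T] by simp
  moreover have "?T \<subseteq> common_multiples G"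
    using Tor_nonzero_imp_two_generators[of 0 G] by (auto simp: common_multiples_def)
  then have "monomial_ideal ?T \<subseteq> (monomial_ideal (common_multiples G) :: ('n, 'k) mpoly set)"
    by (intro monomial_ideal_mono) (auto intro: exp_le_refl)
  moreover have "monomial_ideal (common_multiples G) \<subseteq> (monomial_ideal ?T :: ('n, 'k) mpoly set)"
  proof (rule monomial_ideal_mono)
    fix a assume "a \<in> common_multiples G"
    then have "\<exists>b. (b \<in> common_multiples G \<and> b \<preceq> a) \<and>
      (\<forall>c. c \<in> common_multiples G \<and> c \<preceq> a \<longrightarrow> total_degree b \<le> total_degree c)"
      using exp_le_refl by (intro ex_has_least_nat) blast
    then obtain b where b: "b \<in> common_multiples G" "b \<preceq> a"
      and least: "\<And>c. c \<in> common_multiples G \<Longrightarrow> c \<preceq> a \<Longrightarrow> total_degree b \<le> total_degree c"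
      by blast
    have "c = b" if c: "c \<in> common_multiples G" "c \<preceq> b" for c
    proof (rule exp_le_total_degree_eq[OF c(2)])
      have "total_degree c \<le> total_degree b"
        unfolding total_degree_def by (rule sum_mono) (rule exp_leD[OF c(2)])
      then show "total_degree c = total_degree b"
        using least[OF c(1)] exp_le_trans[OF c(2) b(2)] by simp
    qed
    from Tor_1_nonzero_minimal_common_multiple[OF antichain b(1) this] b(2)
    show "\<exists>b\<in>?T. b \<preceq> a" by blast
  qed
  ultimately show ?thesis by simp
qed

section \<open>Powers of edge ideals\<close>

definition edge_exponents :: "'n set set \<Rightarrow> ('n \<Rightarrow>\<^sub>0 nat) set" where
  "edge_exponents E = {single i 1 + single j 1 | i j. {i, j} \<in> E}"

lemma edge_ideal_eq: "edge_ideal E = (monomial_ideal (edge_exponents E) :: ('n::finite, 'k::field) mpoly set)"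
proof -
  have "{var i * var j | i j. {i, j} \<in> E} = {xpow a :: ('n, 'k) mpoly | a. a \<in> edge_exponents E}"
    unfolding var_def xpow_add[symmetric] edge_exponents_def by blast
  then show ?thesis unfolding edge_ideal_def by (simp only: genideal_xpow)
qed

lemma edge_exponent_at:
  assumes e: "e \<in> edge_exponents E" and l: "lookup e l \<noteq> 0"
  obtains m where "{l, m} \<in> E" "e = single l 1 + single m 1"
proof -
  obtain i j where ij: "{i, j} \<in> E" "e = single i 1 + single j 1"
    using e by (auto simp: edge_exponents_def)
  then have "l = i \<or> l = j"
    using l by (auto simp: lookup_add lookup_single when_def split: if_splits)
  then show ?thesis
    using that ij by (auto simp: add.commute insert_commute)
qed

lemma sumset_edge_degree: "u \<in> sumset k (edge_exponents E) \<Longrightarrow> total_degree u = 2 * k"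
proof (induction k arbitrary: u)
  case 0
  then show ?case by (simp add: total_degree_def)
next
  case (Suc k)
  then obtain w e where "u = w + e" "w \<in> sumset k (edge_exponents E)" "e \<in> edge_exponents E"
    by auto
  then show ?case
    using Suc.IH[of w] by (auto simp: total_degree_add edge_exponents_def total_degree_single)
qed

text \<open>
  All products of \<open>k\<close> edges have degree \<open>2k\<close>, so they are the minimal generators of the \<open>k\<close>-th power.
\<close>

lemma sumset_edge_antichain:
  fixes E :: "'n::finite set set"
  assumes "u \<in> sumset k (edge_exponents E)" "v \<in> sumset k (edge_exponents E)" "u \<preceq> v"
  shows "u = v"
  by (rule exp_le_total_degree_eq[OF assms(3)])
     (simp add: sumset_edge_degree[OF assms(1)] sumset_edge_degree[OF assms(2)])

lemma sumset_summand_at: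
  assumes "u \<in> sumset (Suc k) G" "lookup u l \<noteq> 0"
  obtains w g where "w \<in> sumset k G" "g \<in> G" "u = w + g" "lookup g l \<noteq> 0"
proof -
  have "\<exists>w g. w \<in> sumset k G \<and> g \<in> G \<and> u = w + g \<and> lookup g l \<noteq> 0"
    using assms
  proof (induction k arbitrary: u)
    case 0
    then show ?case by auto
  next
    case (Suc k)
    obtain w g where w: "w \<in> sumset (Suc k) G" "g \<in> G" "u = w + g"
      using Suc.prems(1) unfolding sumset.simps(2)[of "Suc k"] by blast
    show ?case
    proof (cases "lookup g l = 0")
      case True
      then have "lookup w l \<noteq> 0" using Suc.prems(2) w by (simp add: lookup_add)
      then obtain w' g' where w': "w' \<in> sumset k G" "g' \<in> G" "w = w' + g'" "lookup g' l \<noteq> 0"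
        using Suc.IH w by blast
      then have "w' + g \<in> sumset (Suc k) G" using w(2) by auto
      moreover have "u = (w' + g) + g'" by (simp add: w w' ac_simps)
      ultimately show ?thesis using w' by blast
    qed (use w in blast)
  qed
  then show ?thesis using that by blast
qed

text \<open>
  If two distinct products \<open>u\<close> and \<open>v\<close> of at least two edges divide \<open>x\<^sup>a\<close>, then so do two distinct
  products with a common edge. Choose \<open>j\<close> with larger exponent in \<open>v\<close> than in \<open>u\<close> and an edge
  \<open>f = {j, l}\<close> of \<open>v\<close>. If \<open>l\<close> occurs in \<open>u\<close>, replace an edge \<open>{l, m}\<close> of \<open>u\<close> by \<open>f\<close>, which multiplies
  \<open>u\<close> by \<open>x\<^sub>j / x\<^sub>m\<close>; if \<open>m = j\<close>, then \<open>u\<close> and \<open>v\<close> already share \<open>f\<close>. If \<open>l\<close> does not occur in \<open>u\<close>,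
  replace any edge of \<open>u\<close> by \<open>f\<close>. The exponents grow only at \<open>j\<close> and \<open>l\<close>, by one, and only where
  \<open>v\<close> exceeds \<open>u\<close>. The new product shares with \<open>u\<close> all the edges that were not replaced.
\<close>

lemma edge_exchange:
  assumes "simple_graph E"
    and u: "u \<in> sumset (Suc (Suc k)) (edge_exponents E)" "u \<preceq> a"
    and v: "v \<in> sumset (Suc (Suc k)) (edge_exponents E)" "v \<preceq> a"
    and "u \<noteq> v"
  obtains e p q where "e \<in> edge_exponents E"
    "p \<in> sumset (Suc k) (edge_exponents E)" "q \<in> sumset (Suc k) (edge_exponents E)"
    "p \<noteq> q" "p + e \<preceq> a" "q + e \<preceq> a"
proof -
  let ?X = "edge_exponents E"
  note result = that
  \<comment> \<open>Replacing one edge e of u by another edge f leaves at least one edge h in common.\<close>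
  have swap: thesis
    if w: "w \<in> sumset (Suc k) ?X" "e \<in> ?X" "u = w + e" and f: "f \<in> ?X" "e \<noteq> f" "w + f \<preceq> a" for w e f
  proof -
    obtain s h where s: "s \<in> sumset k ?X" "h \<in> ?X" "w = s + h" using w(1) by auto
    have "s + e \<in> sumset (Suc k) ?X" "s + f \<in> sumset (Suc k) ?X"
      using s w(2) f(1) by auto
    moreover have "s + e + h \<preceq> a" "s + f + h \<preceq> a"
      using u(2) f(3) by (simp_all add: w(3) s(3) ac_simps)
    ultimately show thesis using result[of h "s + e" "s + f"] s(2) f(2) by simp
  qed
  have "\<not> v \<preceq> u" using sumset_edge_antichain[OF v(1) u(1)] \<open>u \<noteq> v\<close> by blast
  then obtain j where j: "lookup u j < lookup v j" by (auto simp: exp_le_def not_le)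
  then have "lookup v j \<noteq> 0" by simp
  then obtain w' f where w': "w' \<in> sumset (Suc k) ?X" "f \<in> ?X" "v = w' + f" "lookup f j \<noteq> 0"
    by (rule sumset_summand_at[OF v(1)])
  obtain l where l: "{j, l} \<in> E" "f = single j 1 + single l 1"
    by (rule edge_exponent_at[OF w'(2,4)])
  have "j \<noteq> l" using l(1) \<open>simple_graph E\<close> by (auto simp: simple_graph_def)
  have f_nth: "lookup f x = (if x = j \<or> x = l then 1 else 0)" for x
    using \<open>j \<noteq> l\<close> by (auto simp: l(2) lookup_add lookup_single when_def)
  have ua: "lookup u x \<le> lookup a x" and va: "lookup v x \<le> lookup a x" for x
    by (rule exp_leD[OF u(2)], rule exp_leD[OF v(2)])
  show thesis
  proof (cases "lookup u l = 0")
    case True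
    obtain w e where w: "w \<in> sumset (Suc k) ?X" "e \<in> ?X" "u = w + e" using u(1) by auto
    have "lookup e l = 0" using True by (simp add: w lookup_add)
    then have "e \<noteq> f" using f_nth[of l] by auto
    moreover have "w + f \<preceq> a"
    proof (rule exp_leI)
      fix x
      have "lookup w x \<le> lookup u x" by (simp add: w lookup_add)
      moreover have "lookup u x + lookup f x \<le> lookup a x"
        using j True ua[of x] va[of x] w'(3) by (cases "x = j"; cases "x = l") (auto simp: f_nth lookup_add)
      ultimately show "lookup (w + f) x \<le> lookup a x" by (simp add: lookup_add)
    qed
    ultimately show ?thesis using swap w w'(2) by blast
  next
    case False
    then obtain w e where w: "w \<in> sumset (Suc k) ?X" "e \<in> ?X" "u = w + e" "lookup e l \<noteq> 0"
      by (rule sumset_summand_at[OF u(1)])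
    obtain m where m: "e = single l 1 + single m 1"
      by (rule edge_exponent_at[OF w(2,4)])
    show ?thesis
    proof (cases "m = j")
      case True
      then have "e = f" by (simp add: m l(2) add.commute)
      then show ?thesis
        using result[of f w w'] w w' \<open>u \<noteq> v\<close> u(2) v(2) by auto
    next
      case False
      have "lookup f j \<noteq> lookup e j"
        using False \<open>j \<noteq> l\<close> by (simp add: f_nth m lookup_add lookup_single when_def)
      then have "e \<noteq> f" by auto
      moreover have "w + f \<preceq> a"
      proof (rule exp_leI)
        fix x
        show "lookup (w + f) x \<le> lookup a x"
          using j ua[of x] va[of x] False \<open>j \<noteq> l\<close>
          by (cases "x = j"; cases "x = l") (auto simp: f_nth w(3) m lookup_add lookup_single when_def split: if_splits)
      qed
      ultimately show ?thesis using swap w w'(2) by blast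
    qed
  qed
qed

lemma HS_1_edge_ideal_power:
  fixes I :: "('n::finite, 'k::field) mpoly set"
  assumes "I = edge_ideal E"
  shows "HS 1 (I ^\<^sub>S k) = monomial_ideal (common_multiples (sumset k (edge_exponents E)))"
  unfolding assms edge_ideal_eq monomial_ideal_power
  by (rule HS_1_monomial_ideal) (rule sumset_edge_antichain)

text \<open>
  Common multiples of two products of \<open>k\<close> edges turn into common multiples of two products of \<open>k + 1\<close>
  edges on multiplication by an edge; the exchange lemma shows that all arise in this way.
\<close>

lemma HS_1_edge_ideal_power_Suc:
  fixes I :: "('n::finite, 'k::field) mpoly set"
  assumes E: "simple_graph E" and I: "I = edge_ideal E" and "k \<ge> 1"
  shows "HS 1 (I ^\<^sub>S (k + 1)) = I \<cdot>\<^sub>S HS 1 (I ^\<^sub>S k)"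
proof -
  let ?X = "edge_exponents E"
  obtain k' where k: "k = Suc k'" using \<open>k \<ge> 1\<close> by (cases k) auto
  have "monomial_ideal (common_multiples (sumset (k + 1) ?X))
    = (monomial_ideal {e + a | e a. e \<in> ?X \<and> a \<in> common_multiples (sumset k ?X)} :: ('n, 'k) mpoly set)"
    (is "?L = ?R")
  proof
    show "?L \<subseteq> ?R"
    proof (rule monomial_ideal_mono)
      fix a assume "a \<in> common_multiples (sumset (k + 1) ?X)"
      then have "a \<in> common_multiples (sumset (Suc (Suc k')) ?X)"
        by (simp only: k Suc_eq_plus1)
      then obtain u v where "u \<in> sumset (Suc (Suc k')) ?X" "v \<in> sumset (Suc (Suc k')) ?X"
        "u \<noteq> v" "u \<preceq> a" "v \<preceq> a"
        unfolding common_multiples_def by blast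
      then obtain e p q where e: "e \<in> ?X" and pq: "p \<in> sumset k ?X" "q \<in> sumset k ?X" "p \<noteq> q"
        and le: "p + e \<preceq> a" "q + e \<preceq> a"
        using edge_exchange[OF E] unfolding k by metis
      have "e \<preceq> a" using le(1) exp_le_add_left exp_le_trans by blast
      then have a: "e + (a - e) = a" using exp_le_diff_add add.commute by metis
      have "p \<preceq> a - e" "q \<preceq> a - e"
        using le by (auto simp: exp_le_def lookup_add lookup_minus intro: add_le_imp_le_diff)
      then have "a - e \<in> common_multiples (sumset k ?X)"
        using pq by (auto simp: common_multiples_def)
      then show "\<exists>b\<in>{e + a | e a. e \<in> ?X \<and> a \<in> common_multiples (sumset k ?X)}. b \<preceq> a"
        using e a exp_le_refl by (metis (mono_tags, lifting) mem_Collect_eq)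
    qed
    show "?R \<subseteq> ?L"
    proof (rule monomial_ideal_mono)
      fix c assume "c \<in> {e + a | e a. e \<in> ?X \<and> a \<in> common_multiples (sumset k ?X)}"
      then obtain e a u v where c: "c = e + a" "e \<in> ?X" and uv: "u \<in> sumset k ?X" "v \<in> sumset k ?X"
        "u \<noteq> v" "u \<preceq> a" "v \<preceq> a"
        by (auto simp: common_multiples_def)
      have "u + e \<in> sumset (k + 1) ?X" "v + e \<in> sumset (k + 1) ?X" using c uv by auto
      moreover have "u + e \<noteq> v + e" using uv by simp
      moreover have "u + e \<preceq> c" "v + e \<preceq> c"
        unfolding c(1) add.commute[of e] by (intro exp_le_add_mono uv exp_le_refl)+
      ultimately have "c \<in> common_multiples (sumset (k + 1) ?X)"
        unfolding common_multiples_def by blast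
      then show "\<exists>b\<in>common_multiples (sumset (k + 1) ?X). b \<preceq> c" using exp_le_refl by blast
    qed
  qed
  then show ?thesis
    unfolding HS_1_edge_ideal_power[OF I] by (simp only: I edge_ideal_eq monomial_ideal_mult)
qed

section \<open>The module structure\<close>

lemma ideal_HS: "ideal (HS i I) S_ring"
proof -
  interpret ring "S_ring :: ('a::finite, 'b::field) mpoly ring" by (rule ring_S_ring)
  show ?thesis unfolding HS_def by (rule genideal_ideal) simp
qed

context
  fixes I :: "('n::finite, 'k::field) mpoly set"
  assumes I: "ideal I S_ring"
begin

lemma ideal_ideal_power: "ideal (I ^\<^sub>S k) S_ring"
proof (induction k)
  case 0
  show ?case unfolding ideal_power_0 by (rule ideal_S_ringI) simp_all
next
  case (Suc k)
  show ?case unfolding ideal_power_Suc by (rule ring.ideal_prod_is_ideal[OF ring_S_ring Suc I])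
qed

lemma ideal_power_mult_mem: "f \<in> I ^\<^sub>S m \<Longrightarrow> g \<in> I ^\<^sub>S n \<Longrightarrow> f * g \<in> I ^\<^sub>S (m + n)"
proof (induction n arbitrary: g)
  case 0
  then show ?case using ideal_mult_mem[OF ideal_ideal_power, of f m g] by (simp add: mult.commute)
next
  case (Suc n)
  from Suc.prems(2) have "g \<in> I ^\<^sub>S n \<cdot>\<^sub>S I" unfolding ideal_power_Suc .
  then show ?case
  proof induction
    case (prod s t)
    have "f * s \<in> I ^\<^sub>S (m + n)" by (rule Suc.IH[OF Suc.prems(1) prod(1)])
    from ideal_prod.prod[OF this prod(2), of S_ring] show ?case
      using ideal_power_Suc[of I "m + n"] by (simp add: mult.assoc)
  next
    case (sum s t)
    then show ?case
      unfolding S_ring_simps distrib_left by (intro ideal_add_mem[OF ideal_ideal_power])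
  qed
qed

lemma mem_ideal_power_1: "f \<in> I \<Longrightarrow> f \<in> I ^\<^sub>S 1"
  using ideal_prod.prod[of 1 "UNIV :: ('n, 'k) mpoly set" f I S_ring]
  unfolding One_nat_def ideal_power_Suc ideal_power_0 by simp

lemma carrier_rees: "p \<in> carrier (rees I) \<longleftrightarrow> (\<forall>k. coeff p k \<in> I ^\<^sub>S k)"
  by (simp add: rees_def)

lemma rees_mult_closed:
  assumes "p \<in> carrier (rees I)" "q \<in> carrier (rees I)"
  shows "p * q \<in> carrier (rees I)"
  unfolding carrier_rees coeff_mult
proof
  fix n
  show "(\<Sum>i\<le>n. coeff p i * coeff q (n - i)) \<in> I ^\<^sub>S n"
  proof (rule ideal_sum_mem[OF ideal_ideal_power])
    fix i assume "i \<in> {..n}"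
    then show "coeff p i * coeff q (n - i) \<in> I ^\<^sub>S n"
      using assms ideal_power_mult_mem[of "coeff p i" i "coeff q (n - i)" "n - i"]
      by (simp add: carrier_rees)
  qed
qed

lemma cring_rees: "cring (rees I)"
proof (rule cringI)
  have one: "1 \<in> I ^\<^sub>S 0" unfolding ideal_power_0 by simp
  have closed: "0 \<in> carrier (rees I)" "1 \<in> carrier (rees I)"
    "\<And>p q. p \<in> carrier (rees I) \<Longrightarrow> q \<in> carrier (rees I) \<Longrightarrow> p + q \<in> carrier (rees I)"
    "\<And>p. p \<in> carrier (rees I) \<Longrightarrow> - p \<in> carrier (rees I)"
    using one
    by (auto simp: carrier_rees ideal_zero_mem[OF ideal_ideal_power] ideal_add_mem[OF ideal_ideal_power]
        ideal_uminus_mem[OF ideal_ideal_power])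
  note ops = rees_def[of I, THEN arg_cong, of mult, simplified]
    rees_def[of I, THEN arg_cong, of one, simplified]
    rees_def[of I, THEN arg_cong, of zero, simplified]
    rees_def[of I, THEN arg_cong, of add, simplified]
  show "abelian_group (rees I)"
  proof (rule abelian_groupI)
    fix x assume "x \<in> carrier (rees I)"
    then show "\<exists>y\<in>carrier (rees I). y \<oplus>\<^bsub>rees I\<^esub> x = \<zero>\<^bsub>rees I\<^esub>"
      using closed(4) by (intro bexI[of _ "- x"]) (simp_all add: ops)
  qed (use closed in \<open>simp_all add: ops algebra_simps\<close>)
  show "comm_monoid (rees I)"
    by (rule comm_monoidI) (use closed rees_mult_closed in \<open>simp_all add: ops algebra_simps\<close>)
  show "(x \<oplus>\<^bsub>rees I\<^esub> y) \<otimes>\<^bsub>rees I\<^esub> z = x \<otimes>\<^bsub>rees I\<^esub> z \<oplus>\<^bsub>rees I\<^esub> y \<otimes>\<^bsub>rees I\<^esub> z" for x y z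
    by (simp add: ops algebra_simps)
qed

lemma carrier_HS_algebra:
  "p \<in> carrier (HS_algebra i I) \<longleftrightarrow> coeff p 0 = 0 \<and> (\<forall>k\<ge>1. coeff p k \<in> HS i (I ^\<^sub>S k))"
  by (simp add: HS_algebra_def)

lemma abelian_group_HS_algebra: "abelian_group (HS_algebra i I)"
proof (rule abelian_groupI)
  let ?M = "HS_algebra i I"
  note ops = HS_algebra_def[of i I, THEN arg_cong, of zero, simplified]
    HS_algebra_def[of i I, THEN arg_cong, of add, simplified]
  fix p
  assume p: "p \<in> carrier ?M"
  show "\<exists>y\<in>carrier ?M. y \<oplus>\<^bsub>?M\<^esub> p = \<zero>\<^bsub>?M\<^esub>"
    using p by (intro bexI[of _ "- p"]) (simp_all add: ops carrier_HS_algebra ideal_uminus_mem[OF ideal_HS])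
  show "\<zero>\<^bsub>?M\<^esub> \<oplus>\<^bsub>?M\<^esub> p = p" by (simp add: ops)
  fix q
  show "p \<oplus>\<^bsub>?M\<^esub> q = q \<oplus>\<^bsub>?M\<^esub> p" by (simp add: ops)
  show "p \<oplus>\<^bsub>?M\<^esub> q \<oplus>\<^bsub>?M\<^esub> r = p \<oplus>\<^bsub>?M\<^esub> (q \<oplus>\<^bsub>?M\<^esub> r)" for r by (simp add: ops add.assoc)
  assume "q \<in> carrier ?M"
  with p show "p \<oplus>\<^bsub>?M\<^esub> q \<in> carrier ?M"
    by (simp add: ops carrier_HS_algebra ideal_add_mem[OF ideal_HS])
qed (simp add: HS_algebra_def ideal_zero_mem[OF ideal_HS])

context
  fixes i :: nat
  assumes HS_Suc: "\<And>k. k \<ge> 1 \<Longrightarrow> HS i (I ^\<^sub>S (k + 1)) = I \<cdot>\<^sub>S HS i (I ^\<^sub>S k)"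
begin

text \<open>
  The given equality moves one factor \<open>I\<close> at a time into the homological shift ideal. It holds from
  \<open>k = 1\<close> on, so \<open>g\<close> has to be taken from a component of positive degree.
\<close>

lemma ideal_power_mult_HS:
  "f \<in> I ^\<^sub>S m \<Longrightarrow> k \<ge> 1 \<Longrightarrow> g \<in> HS i (I ^\<^sub>S k) \<Longrightarrow> f * g \<in> HS i (I ^\<^sub>S (m + k))"
proof (induction m arbitrary: f g k)
  case 0
  then show ?case using ideal_mult_mem[OF ideal_HS] by simp
next
  case (Suc m)
  from Suc.prems(1) have "f \<in> I ^\<^sub>S m \<cdot>\<^sub>S I" unfolding ideal_power_Suc .
  then show ?case
  proof induction
    case (prod s t)
    have "t * g \<in> HS i (I ^\<^sub>S (k + 1))"
      unfolding HS_Suc[OF Suc.prems(2)]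
      using ideal_prod.prod[OF prod(2) Suc.prems(3), of S_ring] by simp
    from Suc.IH[OF prod(1) _ this] show ?case by (simp add: mult.assoc)
  next
    case (sum s t)
    then show ?case
      unfolding S_ring_simps distrib_right by (intro ideal_add_mem[OF ideal_HS])
  qed
qed

lemma module_HS_algebra: "Module.module (rees I) (HS_algebra i I)"
proof (rule moduleI[OF cring_rees abelian_group_HS_algebra])
  let ?M = "HS_algebra i I"
  note ops = HS_algebra_def[of i I, THEN arg_cong, of smult, simplified]
    HS_algebra_def[of i I, THEN arg_cong, of add, simplified]
    rees_def[of I, THEN arg_cong, of mult, simplified]
    rees_def[of I, THEN arg_cong, of one, simplified]
    rees_def[of I, THEN arg_cong, of add, simplified]
  show "p \<odot>\<^bsub>?M\<^esub> q \<in> carrier ?M" if p: "p \<in> carrier (rees I)" and q: "q \<in> carrier ?M" for p q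
  proof -
    have "coeff (p * q) n \<in> HS i (I ^\<^sub>S n)" if "n \<ge> 1" for n
      unfolding coeff_mult
    proof (rule ideal_sum_mem[OF ideal_HS])
      fix j assume "j \<in> {..n}"
      \<comment> \<open>For j = n the factor from the module is its coefficient of degree 0, which vanishes.\<close>
      then show "coeff p j * coeff q (n - j) \<in> HS i (I ^\<^sub>S n)"
        using p q ideal_power_mult_HS[of "coeff p j" j "n - j" "coeff q (n - j)"]
        by (cases "j = n") (simp_all add: carrier_rees carrier_HS_algebra ideal_zero_mem[OF ideal_HS])
    qed
    moreover have "coeff (p * q) 0 = 0"
      using q by (simp add: coeff_mult carrier_HS_algebra)
    ultimately show ?thesis by (simp add: ops carrier_HS_algebra)
  qed
qed (simp_all add: HS_algebra_def rees_def algebra_simps)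

text \<open>
  An element of the component of degree \<open>k + 1\<close> is a sum of products \<open>s t\<close> with \<open>s\<close> in \<open>I\<close> and \<open>t\<close> in
  the component of degree \<open>k\<close>, and \<open>s\<close>, placed in degree \<open>1\<close>, belongs to the Rees algebra.
\<close>

lemma generated_in_degree_1_HS_algebra: "generated_in_degree 1 (rees I) (HS_algebra i I)"
  unfolding generated_in_degree_def
proof (intro equalityI subsetI)
  let ?M = "HS_algebra i I"
  fix p assume p: "p \<in> carrier ?M"
  show "p \<in> \<Inter>{N. Module.submodule N (rees I) ?M \<and> graded_component 1 ?M \<subseteq> N}"
  proof (rule InterI, elim CollectE conjE)
    fix N
    assume N: "Module.submodule N (rees I) ?M" and gen: "graded_component 1 ?M \<subseteq> N"
    have zero: "0 \<in> N"
      using subgroup.one_closed[OF Module.submodule.axioms(1)[OF N]] by (simp add: HS_algebra_def)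
    have add: "x + y \<in> N" if "x \<in> N" "y \<in> N" for x y
      using subgroup.m_closed[OF Module.submodule.axioms(1)[OF N] that] by (simp add: HS_algebra_def)
    have smult: "r * x \<in> N" if "r \<in> carrier (rees I)" "x \<in> N" for r x
      using Module.submodule.smult_closed[OF N that] by (simp add: HS_algebra_def)
    have monom: "monom f k \<in> N" if "k \<ge> 1" "f \<in> HS i (I ^\<^sub>S k)" for f k
      using that
    proof (induction k arbitrary: f rule: nat_induct_at_least)
      case base
      then have "monom f 1 \<in> graded_component 1 ?M"
        by (auto simp: graded_component_def carrier_HS_algebra ideal_zero_mem[OF ideal_HS])
      then show ?case using gen by blast
    next
      case (Suc k)
      have "f \<in> I \<cdot>\<^sub>S HS i (I ^\<^sub>S k)" using Suc.prems HS_Suc[OF Suc.hyps] by simp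
      then show ?case
      proof induction
        case (prod s t)
        have "monom s 1 \<in> carrier (rees I)"
          using mem_ideal_power_1[OF prod(1)]
          by (auto simp: carrier_rees ideal_zero_mem[OF ideal_ideal_power])
        from smult[OF this Suc.IH[OF prod(2)]] show ?case by (simp add: mult_monom)
      next
        case (sum s t)
        then show ?case using add by (simp add: add_monom[symmetric])
      qed
    qed
    have "monom (coeff p k) k \<in> N" for k
    proof (cases "k = 0")
      case True
      then show ?thesis using p zero by (simp add: carrier_HS_algebra)
    next
      case False
      then show ?thesis using p by (intro monom) (auto simp only: carrier_HS_algebra)
    qed
    then have "(\<Sum>k\<in>A. monom (coeff p k) k) \<in> N" for A
      by (induction A rule: infinite_finite_induct) (auto simp: zero add)
    then show "p \<in> N" using poly_as_sum_of_monoms[of p] by metis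
  qed
next
  let ?M = "HS_algebra i I"
  fix p assume "p \<in> \<Inter>{N. Module.submodule N (rees I) ?M \<and> graded_component 1 ?M \<subseteq> N}"
  then show "p \<in> carrier ?M"
    using module.carrier_is_submodule[OF module_HS_algebra] by (auto simp: graded_component_def)
qed

end

end

theorem corollary2p4:
  fixes E :: "'n::finite set set"
    and I :: "('n, 'k::field) mpoly set"
  assumes "simple_graph E"
    and "I = edge_ideal E"
  shows "(\<forall>k\<ge>1. HS 1 (I ^\<^sub>S (k + 1)) = I \<cdot>\<^sub>S HS 1 (I ^\<^sub>S k)) \<and>
         Module.module (rees I) (HS_algebra 1 I) \<and>
         generated_in_degree 1 (rees I) (HS_algebra 1 I)"
proof -
  have I: "ideal I S_ring"
    unfolding assms(2) edge_ideal_eq by (rule ideal_monomial_ideal)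
  have HS_Suc: "HS 1 (I ^\<^sub>S (k + 1)) = I \<cdot>\<^sub>S HS 1 (I ^\<^sub>S k)" if "k \<ge> 1" for k
    using HS_1_edge_ideal_power_Suc[OF assms that] .
  show ?thesis
    using HS_Suc module_HS_algebra[OF I HS_Suc] generated_in_degree_1_HS_algebra[OF I HS_Suc]
    by blast
qed

end
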